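(* Let $b_1,b_2\in\mathbb{R}^2$ be linearly independent, let $\mathcal{P}=\{a\in\mathbb{R}^2: |a\cdot b_1|\le 1,\ |a\cdot b_2|\le 1\}$, and let $\|a\|_{\mathcal{P}}=\max\{|a\cdot b_1|,|a\cdot b_2|\}$. Let $(G,p)$ be a well-positioned and regular bar-joint framework in $(\mathbb{R}^2,\|\cdot\|_{\mathcal{P}})$. The following statements are equivalent: (i) $(G,p)$ is minimally infinitesimally rigid. (ii) The monochrome subgraphs $G_1$ and $G_2$ induced by the framework colouring of $(G,p)$ are edge-disjoint spanning trees of $G$. (iii) $G$ is $(2,2)$-tight.
   Context: Bar-joint framework in a normed linear space $(X,\|\cdot\|)$: a pair $(G,p)$ where $G=(V,E)$ is a finite simple connected graph with vertices $v_1,\dots,v_n$ and $p=(p_1,\dots,p_n)\in X^n$ ($p$ is called a realisation of $G$). Infinitesimal flex of $(G,p)$: a vector $u=(u_1,\dots,u_n)\in X^n$ with $\|(p_i+tu_i)-(p_j+tu_j)\|-\|p_i-p_j\|=o(t)$ as $t\to 0$ for every edge $v_iv_j\in E$. Rigid motion of $X$: a family $\{\gamma_x\}_{x\in X}$ of continuous paths $\gamma_x:[-1,1]\to X$, each differentiable at $0$ with $\gamma_x(0)=x$, such that $\|\gamma_x(t)-\gamma_y(t)\|=\|x-y\|$ for all $t\in[-1,1]$, $x,y\in X$. A flex $u$ is trivial if $u=(\gamma_{p_1}'(0),\dots,\gamma_{p_n}'(0))$ for some rigid motion. $(G,p)$ is infinitesimally rigid if every infinitesimal flex is trivial, and infinitesimally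 flexible otherwise. It is minimally infinitesimally rigid if it is infinitesimally rigid and removing any single edge from $G$ (keeping all vertices and placements) yields an infinitesimally flexible framework (the same definitions are applied to the resulting graph even if it is disconnected). Well-positioned: for each edge $v_iv_j\in E$ there is a unique index $k\in\{1,2\}$ with $\|p_i-p_j\|_{\mathcal{P}}=|(p_i-p_j)\cdot b_k|$; this $k$ is the framework colour of the edge. The framework colouring assigns to each edge its framework colour, and $G_k$ is the subgraph of $G$ (on the vertex set $V$) formed by all edges of framework colour $k$. Rigidity matrix: for $a\in\mathbb{R}^2$ set $\kappa(a)=b_k$ if there is a unique index $k$ with $\|a\|_{\mathcal{P}}=|a\cdot b_k|$, and $\kappa(a)=0\in\mathbb{R}^2$ otherwise. $R_{\mathcal{P}}(G,p)$ is the $|E|\times 2n$ matrix whose row for the edge $v_iv_j$ has $\kappa(p_i-p_j)$ in the two columns of $p_i$, $-\kappa(p_i-p_j)$ in the two columns of $p_j$, and zeros elsewhere. $(G,p)$ is regular if $\operatorname{rank} R_{\mathcal{P}}(G,p)$ is maximal over all realisations $p'\in\mathbb{R}^{2n}$ of $G$. A simple connected graph $G=(V,E)$ is $(2,2)$-sparse if $|E(H)|\le 2|V(H)|-2$ for all (nonempty) subgraphs $H=(V(H),E(H))$, and $(2,2)$-tight if in addition $|E|=2|V|-2$. *)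

theory Defs
  imports "HOL-Analysis.Analysis" "HOL-Library.Landau_Symbols"
begin

section \<open>Graphs\<close>

text \<open>
  The vertices \<open>v\<^sub>1, \<dots>, v\<^sub>n\<close> are all the elements of a finite linearly ordered type; a graph on
  them is given by its set of edges, which are two-element sets of vertices. The order only
  serves to orient the edges in the rigidity matrix.
\<close>

definition simple_graph :: "'v set set \<Rightarrow> bool" where
  "simple_graph E \<longleftrightarrow> (\<forall>e\<in>E. card e = 2)"

definition connected_graph :: "'v set set \<Rightarrow> bool" where
  "connected_graph E \<longleftrightarrow> (\<forall>v w. (v, w) \<in> {(x, y). {x, y} \<in> E}\<^sup>*)"

definition graph_cycle :: "'v set set \<Rightarrow> 'v list \<Rightarrow> bool" where
  "graph_cycle E c \<longleftrightarrow> 3 \<le> length c \<and> distinct c \<and>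
     (\<forall>i. Suc i < length c \<longrightarrow> {c ! i, c ! Suc i} \<in> E) \<and> {last c, hd c} \<in> E"

definition spanning_tree :: "'v set set \<Rightarrow> 'v set set \<Rightarrow> bool" where
  "spanning_tree T E \<longleftrightarrow> T \<subseteq> E \<and> connected_graph T \<and> (\<nexists>c. graph_cycle T c)"

text \<open>Here \<open>(W, F)\<close> ranges over the nonempty subgraphs.\<close>

definition sparse_2_2 :: "'v set set \<Rightarrow> bool" where
  "sparse_2_2 E \<longleftrightarrow>
     (\<forall>W F. W \<noteq> {} \<and> F \<subseteq> E \<and> \<Union>F \<subseteq> W \<longrightarrow> int (card F) \<le> 2 * int (card W) - 2)"

definition tight_2_2 :: "'v::finite set set \<Rightarrow> bool" where
  "tight_2_2 E \<longleftrightarrow> sparse_2_2 E \<and> int (card E) = 2 * int CARD('v) - 2"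

section \<open>Infinitesimal rigidity with respect to a norm\<close>

text \<open>
  The norm \<open>N\<close> of the framework space is a parameter, in general different from the Euclidean
  norm of the type. All norms on a finite-dimensional space are equivalent, so continuity,
  differentiability and derivatives of paths are those of the type.
\<close>

definition infinitesimal_flex ::
  "('a::euclidean_space \<Rightarrow> real) \<Rightarrow> 'v set set \<Rightarrow> ('v \<Rightarrow> 'a) \<Rightarrow> ('v \<Rightarrow> 'a) \<Rightarrow> bool" where
  "infinitesimal_flex N E p u \<longleftrightarrow>
     (\<forall>i j. {i, j} \<in> E \<longrightarrow>
       (\<lambda>t. N ((p i + t *\<^sub>R u i) - (p j + t *\<^sub>R u j)) - N (p i - p j)) \<in> o[at 0](\<lambda>t::real. t))"

definition rigid_motion ::
  "('a::euclidean_space \<Rightarrow> real) \<Rightarrow> ('a \<Rightarrow> real \<Rightarrow> 'a) \<Rightarrow> bool" where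
  "rigid_motion N \<gamma> \<longleftrightarrow>
     (\<forall>x. continuous_on {-1..1} (\<gamma> x) \<and> \<gamma> x differentiable (at 0) \<and> \<gamma> x 0 = x) \<and>
     (\<forall>t\<in>{-1..1}. \<forall>x y. N (\<gamma> x t - \<gamma> y t) = N (x - y))"

definition trivial_flex ::
  "('a::euclidean_space \<Rightarrow> real) \<Rightarrow> ('v \<Rightarrow> 'a) \<Rightarrow> ('v \<Rightarrow> 'a) \<Rightarrow> bool" where
  "trivial_flex N p u \<longleftrightarrow>
     (\<exists>\<gamma>. rigid_motion N \<gamma> \<and> (\<forall>v. u v = vector_derivative (\<gamma> (p v)) (at 0)))"

definition infinitesimally_rigid ::
  "('a::euclidean_space \<Rightarrow> real) \<Rightarrow> 'v set set \<Rightarrow> ('v \<Rightarrow> 'a) \<Rightarrow> bool" where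
  "infinitesimally_rigid N E p \<longleftrightarrow> (\<forall>u. infinitesimal_flex N E p u \<longrightarrow> trivial_flex N p u)"

definition minimally_infinitesimally_rigid ::
  "('a::euclidean_space \<Rightarrow> real) \<Rightarrow> 'v set set \<Rightarrow> ('v \<Rightarrow> 'a) \<Rightarrow> bool" where
  "minimally_infinitesimally_rigid N E p \<longleftrightarrow>
     infinitesimally_rigid N E p \<and> (\<forall>e\<in>E. \<not> infinitesimally_rigid N (E - {e}) p)"

section \<open>The quadrilateral norm and framework colours\<close>

text \<open>The indices 1 and 2 of the two vectors are the two elements of the type \<^typ>\<open>2\<close>.\<close>

definition quadrilateral :: "(2 \<Rightarrow> real^2) \<Rightarrow> (real^2) set" where
  "quadrilateral b = {a. \<bar>a \<bullet> b 1\<bar> \<le> 1 \<and> \<bar>a \<bullet> b 2\<bar> \<le> 1}"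

definition quad_norm :: "(2 \<Rightarrow> real^2) \<Rightarrow> real^2 \<Rightarrow> real" where
  "quad_norm b a = max \<bar>a \<bullet> b 1\<bar> \<bar>a \<bullet> b 2\<bar>"

lemma quad_norm_unit_ball: "{a. quad_norm b a \<le> 1} = quadrilateral b"
  by (auto simp: quad_norm_def quadrilateral_def)

definition attains :: "(2 \<Rightarrow> real^2) \<Rightarrow> real^2 \<Rightarrow> 2 \<Rightarrow> bool" where
  "attains b a k \<longleftrightarrow> quad_norm b a = \<bar>a \<bullet> b k\<bar>"

definition well_positioned :: "(2 \<Rightarrow> real^2) \<Rightarrow> 'v set set \<Rightarrow> ('v \<Rightarrow> real^2) \<Rightarrow> bool" where
  "well_positioned b E p \<longleftrightarrow> (\<forall>i j. {i, j} \<in> E \<longrightarrow> (\<exists>!k. attains b (p i - p j) k))"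

lemma attains_minus: "attains b (- a) k \<longleftrightarrow> attains b a k"
  by (simp add: attains_def quad_norm_def)

text \<open>By \<open>attains_minus\<close>, the colour does not depend on the order of the two endpoints.\<close>

definition monochrome_subgraph ::
  "(2 \<Rightarrow> real^2) \<Rightarrow> 'v set set \<Rightarrow> ('v \<Rightarrow> real^2) \<Rightarrow> 2 \<Rightarrow> 'v set set" where
  "monochrome_subgraph b E p k =
     {{i, j} | i j. {i, j} \<in> E \<and> (THE k'. attains b (p i - p j) k') = k}"

section \<open>The rigidity matrix\<close>

definition kappa :: "(2 \<Rightarrow> real^2) \<Rightarrow> real^2 \<Rightarrow> real^2" where
  "kappa b a = (if \<exists>!k. attains b a k then b (THE k. attains b a k) else 0)"

text \<open>
  Columns are indexed by the pairs of a vertex and a coordinate. Since matrices are indexed by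
  types, there is a row for every set of vertices, and the rows that do not belong to an edge are
  zero; by the lemma below they do not contribute to the rank. The edge \<open>v\<^sub>iv\<^sub>j\<close> is
  oriented so that \<open>i < j\<close>; the opposite orientation would negate its row, as \<open>\<kappa>(-a) = \<kappa>(a)\<close>.
\<close>

definition rigidity_matrix ::
  "(2 \<Rightarrow> real^2) \<Rightarrow> 'v::{finite,linorder} set set \<Rightarrow> ('v \<Rightarrow> real^2) \<Rightarrow> real^('v \<times> 2)^('v set)" where
  "rigidity_matrix b E p =
     (\<chi> e vc. if e \<in> E then
        (let i = Min e; j = Max e; \<kappa> = kappa b (p i - p j) in
         if fst vc = i then \<kappa> $ snd vc else if fst vc = j then - (\<kappa> $ snd vc) else 0)
      else 0)"

lemma rank_rigidity_matrix:
  "rank (rigidity_matrix b E p) = dim ((\<lambda>e. row e (rigidity_matrix b E p)) ` E)"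
proof -
  let ?R = "rigidity_matrix b E p"
  have "row e ?R = 0" if "e \<notin> E" for e
    using that by (simp add: row_def rigidity_matrix_def vec_eq_iff)
  then have "span (rows ?R) = span ((\<lambda>e. row e ?R) ` E)"
    unfolding rows_def span_eq by (auto intro: span_base simp: span_zero)
       (metis image_eqI span_base span_zero)
  then show ?thesis
    by (metis row_rank_def dim_span dim_vec_eq)
qed

definition regular ::
  "(2 \<Rightarrow> real^2) \<Rightarrow> 'v::{finite,linorder} set set \<Rightarrow> ('v \<Rightarrow> real^2) \<Rightarrow> bool" where
  "regular b E p \<longleftrightarrow> (\<forall>p'. rank (rigidity_matrix b E p') \<le> rank (rigidity_matrix b E p))"

end

theory Submission
  imports Defs
begin

text \<open>
  Every trivial flex is constant, and \<open>u\<close> is an infinitesimal flex iff each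
  coordinate \<open>u \<bullet> b k\<close> is constant along the edges of colour \<open>k\<close>. Hence the framework is rigid iff both
  monochrome subgraphs are connected, which gives (i) \<open>\<longleftrightarrow>\<close> (ii), and (ii) \<open>\<longrightarrow>\<close> (iii) by counting edges.

  For (iii) \<open>\<longrightarrow>\<close> (i), regularity reduces the claim to finding one placement of a tight graph whose two
  colour classes connect all vertices. Writing \<open>p v\<close> in the coordinates \<open>s + t\<close> and \<open>s - t\<close>, an edge has
  colour 1 iff its endpoints are ordered in the same way by \<open>s\<close> and \<open>t\<close>, so only two linear orders are
  needed. They are found by induction: a vertex of degree 2 can always be inserted; a maximal proper
  tight subgraph is contracted to a vertex (the quotient is simple by maximality) and afterwards
  blown up again as a small cluster; and if there is no proper tight subgraph, a vertex of degree 3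
  is removed and replaced by an edge between two non-adjacent neighbours, unless the graph is \<open>K\<^sub>4\<close>.
\<close>

section \<open>Connectivity and spanning trees\<close>

text \<open>Connectivity is tested by real functions that agree at the two ends of every edge, since
  the coordinates of a flex are exactly such functions. Rigidity and connectivity then become the
  same kind of condition, and a contraction amounts to composing the test function with a map.

  Regularity helps because rank and kernel dimension have a constant sum: one placement whose kernel
  consists of constants only forces the same on a regular placement, although the two may colour the
  edges differently.

  An abstract decomposition into two trees would not suffice, because the colours have to come from
  a placement; so every reduction has to be undone geometrically. A new vertex can always be placed
  so that it sees two or three old ones in the required colours. The difficulty is combinatorial:
  replacing a vertex of degree 3 by an edge can break sparsity on a tight subset containing both
  ends, and is impossible if the three neighbours form a triangle. Contracting tight subsets
  beforehand disposes of the first problem; in their absence a vertex together with such a triangle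
  is already tight, hence the whole graph.\<close>

definition compatible :: "'v set set \<Rightarrow> ('v \<Rightarrow> real) \<Rightarrow> bool" where
  "compatible F f \<longleftrightarrow> (\<forall>x y. {x, y} \<in> F \<longrightarrow> f x = f y)"

text \<open>\<open>W\<close> lies in one component of \<open>F\<close>; the edges of
  \<open>F\<close> may leave \<open>W\<close>. The form with test functions is chosen because
  coordinates of flexes can be inserted directly.\<close>

definition connects :: "'v set \<Rightarrow> 'v set set \<Rightarrow> bool" where
  "connects W F \<longleftrightarrow> (\<forall>f. compatible F f \<longrightarrow> (\<forall>x\<in>W. \<forall>y\<in>W. f x = f y))"

lemma compatibleD: "compatible F f \<Longrightarrow> {x, y} \<in> F \<Longrightarrow> f x = f y"
  by (auto simp: compatible_def)

lemma compatible_mono: "compatible F f \<Longrightarrow> F' \<subseteq> F \<Longrightarrow> compatible F' f"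
  by (auto simp: compatible_def)

lemma compatible_Diff_edge:
  assumes "compatible (F - {{x, y}}) f" "f x = f y"
  shows "compatible F f"
  unfolding compatible_def
proof (intro allI impI)
  fix u v assume "{u, v} \<in> F"
  then show "f u = f v"
    using compatibleD[OF assms(1), of u v] assms(2)
    by (cases "{u, v} = {x, y}") (auto simp: doubleton_eq_iff)
qed

lemma connectsD: "connects W F \<Longrightarrow> compatible F f \<Longrightarrow> x \<in> W \<Longrightarrow> y \<in> W \<Longrightarrow> f x = f y"
  by (auto simp: connects_def)

lemma connectsI:
  "(\<And>f x y. compatible F f \<Longrightarrow> x \<in> W \<Longrightarrow> y \<in> W \<Longrightarrow> f x = f y) \<Longrightarrow> connects W F"
  by (simp add: connects_def)

lemma connects_insert:
  assumes "connects W F" "F \<subseteq> F'" "a \<in> W" "{v, a} \<in> F'"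
  shows "connects (insert v W) F'"
  unfolding connects_def
proof (intro allI impI)
  fix f assume f: "compatible F' f"
  have "f x = f a" if "x \<in> W" for x
    using connectsD[OF assms(1) compatible_mono[OF f assms(2)] that assms(3)] .
  then show "\<forall>x\<in>insert v W. \<forall>y\<in>insert v W. f x = f y"
    using compatibleD[OF f assms(4)] by auto
qed

text \<open>The path through \<open>v\<close> replaces the edge between \<open>a\<close> and
  \<open>b\<close>: a test function has \<open>f a = f v = f b\<close>, hence it is also compatible
  with the edge that may be missing in \<open>F'\<close>.\<close>

lemma connects_subdivide:
  assumes "connects W F" "F - {{a, b}} \<subseteq> F'" "a \<in> W" "{v, a} \<in> F'" "{v, b} \<in> F'"
  shows "connects (insert v W) F'"
  unfolding connects_def
proof (intro allI impI)
  fix f assume f: "compatible F' f"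
  have va: "f v = f a" "f v = f b"
    using compatibleD[OF f assms(4)] compatibleD[OF f assms(5)] by auto
  have "compatible F f"
    unfolding compatible_def
  proof (intro allI impI)
    fix x y assume xy: "{x, y} \<in> F"
    show "f x = f y"
    proof (cases "{x, y} = {a, b}")
      case True
      then show ?thesis using va by (auto simp: doubleton_eq_iff)
    next
      case False
      then show ?thesis using xy assms(2) compatibleD[OF f] by blast
    qed
  qed
  then have "f x = f a" if "x \<in> W" for x
    using connectsD[OF assms(1) _ that assms(3)] by blast
  then show "\<forall>x\<in>insert v W. \<forall>y\<in>insert v W. f x = f y"
    using va by auto
qed

text \<open>Induction by contracting an edge: \<open>\<phi>\<close> maps \<open>y\<close> to
  \<open>x\<close>, which costs exactly one vertex and at least one edge. Parallel edges may merge,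
  but this only lowers the edge count and so does not harm the bound.\<close>

lemma connects_card:
  assumes "finite W" "finite F" "connects W F" "W \<noteq> {}" "\<Union>F \<subseteq> W"
  shows "card W \<le> Suc (card F)"
  using assms
proof (induction "card W" arbitrary: W F rule: less_induct)
  case less
  show ?case
  proof (cases "card W \<le> 1")
    case False
    have "\<exists>x y. {x, y} \<in> F \<and> x \<noteq> y"
    proof (rule ccontr)
      assume none: "\<not> ?thesis"
      obtain a b where ab: "a \<in> W" "b \<in> W" "a \<noteq> b"
        using False less.prems(1) by (metis card_le_Suc0_iff_eq One_nat_def)
      have "compatible F (\<lambda>x. if x = a then 1 else 0)"
        using none by (auto simp: compatible_def)
      from connectsD[OF less.prems(3) this ab(1,2)] ab(3) show False by simp
    qed
    then obtain x y where xy: "{x, y} \<in> F" "x \<noteq> y" by blast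
    then have xyW: "x \<in> W" "y \<in> W" using less.prems(5) by auto
    define \<phi> where "\<phi> z = (if z = y then x else z)" for z
    define F' where "F' = (\<lambda>e. \<phi> ` e) ` (F - {{x, y}})"
    have "connects (W - {y}) F'"
      unfolding connects_def
    proof (intro allI impI)
      fix f assume f: "compatible F' f"
      have "compatible F (f \<circ> \<phi>)"
        unfolding compatible_def
      proof (intro allI impI)
        fix u v assume uv: "{u, v} \<in> F"
        show "(f \<circ> \<phi>) u = (f \<circ> \<phi>) v"
        proof (cases "{u, v} = {x, y}")
          case True
          then show ?thesis using xy by (auto simp: \<phi>_def doubleton_eq_iff)
        next
          case False
          then have "\<phi> ` {u, v} \<in> F'" using uv unfolding F'_def by blast
          then show ?thesis using compatibleD[OF f, of "\<phi> u" "\<phi> v"] by simp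
        qed
      qed
      then have "\<forall>u\<in>W. \<forall>v\<in>W. (f \<circ> \<phi>) u = (f \<circ> \<phi>) v"
        using less.prems(3) unfolding connects_def by blast
      then show "\<forall>u\<in>W - {y}. \<forall>v\<in>W - {y}. f u = f v"
        by (metis DiffE \<phi>_def comp_apply insertCI)
    qed
    moreover have "\<Union>F' \<subseteq> W - {y}"
      using less.prems(5) xyW xy unfolding F'_def \<phi>_def by auto
    moreover have "card (W - {y}) < card W"
      using less.prems(1) xyW by (meson card_Diff1_less)
    moreover have "finite F'" using less.prems(2) unfolding F'_def by simp
    moreover have "W - {y} \<noteq> {}" using xyW xy by auto
    ultimately have "card (W - {y}) \<le> Suc (card F')"
      using less.hyps[of "W - {y}" F'] less.prems(1) by simp
    moreover have "card F' \<le> card (F - {{x, y}})"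
      unfolding F'_def using less.prems(2) by (simp add: card_image_le)
    moreover have "card (F - {{x, y}}) + 1 = card F"
      using less.prems(2) xy(1) by (metis Suc_eq_plus1 card_Suc_Diff1)
    moreover have "card (W - {y}) + 1 = card W"
      using less.prems(1) xyW by (metis Suc_eq_plus1 card_Suc_Diff1)
    ultimately show ?thesis by linarith
  qed simp
qed

text \<open>Every edge is a bridge, so for proper edges \<open>F\<close> is a forest. The function
  \<open>f\<close> certifies that the ends of an edge fall into different components once that edge
  is deleted.\<close>

definition separated :: "'v set set \<Rightarrow> bool" where
  "separated F \<longleftrightarrow> (\<forall>x y. {x, y} \<in> F \<longrightarrow> (\<exists>f. compatible (F - {{x, y}}) f \<and> f x \<noteq> f y))"

lemma separatedD:
  "separated F \<Longrightarrow> {x, y} \<in> F \<Longrightarrow> \<exists>f. compatible (F - {{x, y}}) f \<and> f x \<noteq> f y"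
  by (auto simp: separated_def)

lemma separated_subset:
  assumes "separated F" "F' \<subseteq> F"
  shows "separated F'"
  unfolding separated_def
proof (intro allI impI)
  fix x y assume "{x, y} \<in> F'"
  then obtain f where "compatible (F - {{x, y}}) f" "f x \<noteq> f y"
    using separatedD[OF assms(1)] assms(2) by blast
  then show "\<exists>f. compatible (F' - {{x, y}}) f \<and> f x \<noteq> f y"
    using compatible_mono[of "F - {{x, y}}" f "F' - {{x, y}}"] assms(2) by blast
qed

text \<open>The forest bound, again by contracting an edge \<open>e\<close>. Here no two edges may
  merge and none may become a loop; both follow because the certificates of the other edges survive
  the contraction.\<close>

lemma separated_card:
  assumes "finite W" "finite F" "separated F" "W \<noteq> {}" "\<Union>F \<subseteq> W" "\<forall>e\<in>F. card e = 2"
  shows "Suc (card F) \<le> card W"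
  using assms
proof (induction "card F" arbitrary: W F)
  case 0
  then show ?case by (metis Suc_leI card_gt_0_iff)
next
  case (Suc n)
  have pair: "\<exists>u v. e = {u, v}" if "e \<in> F" for e
    using Suc.prems(6) that by (meson card_2_iff)
  obtain e where e: "e \<in> F" using Suc.hyps(2) by fastforce
  then have "card e = 2" using Suc.prems(6) by blast
  then obtain x y where xy: "e = {x, y}" "x \<noteq> y" by (meson card_2_iff)
  then have xyW: "x \<in> W" "y \<in> W" using e Suc.prems(5) by auto
  define \<phi> where "\<phi> z = (if z = y then x else z)" for z
  define F' where "F' = (\<lambda>e. \<phi> ` e) ` (F - {e})"
  \<comment> \<open>The certificate for another edge is still compatible with \<open>e\<close>, so
    it takes the same value at \<open>x\<close> and \<open>y\<close> and factors through
    \<open>\<phi>\<close>.\<close>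
  have fac: "\<exists>f. compatible (F - {{u, v}}) f \<and> f u \<noteq> f v \<and> (\<forall>z. f (\<phi> z) = f z)"
    if uv: "{u, v} \<in> F - {e}" for u v
  proof -
    obtain f where f: "compatible (F - {{u, v}}) f" "f u \<noteq> f v"
      using separatedD[OF Suc.prems(3)] uv by blast
    have "f x = f y" using compatibleD[OF f(1), of x y] e uv xy by auto
    with f show ?thesis unfolding \<phi>_def by metis
  qed
  \<comment> \<open>If \<open>e1\<close> and \<open>e2\<close> had the same image, the certificate
    for \<open>e1\<close> would take the same values on both, yet it is constant on
    \<open>e2\<close> and not on \<open>e1\<close>.\<close>
  have inj: "inj_on (\<lambda>e. \<phi> ` e) (F - {e})"
  proof (rule inj_onI, rule ccontr)
    fix e1 e2 assume e1: "e1 \<in> F - {e}" and e2: "e2 \<in> F - {e}"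
      and eq: "\<phi> ` e1 = \<phi> ` e2" and ne: "e1 \<noteq> e2"
    obtain u v where uv: "e1 = {u, v}" using e1 pair by blast
    obtain w z where wz: "e2 = {w, z}" using e2 pair by blast
    obtain f where f: "compatible (F - {{u, v}}) f" "f u \<noteq> f v" "\<forall>z. f (\<phi> z) = f z"
      using fac e1 uv by blast
    have "f w = f z" using compatibleD[OF f(1), of w z] e2 ne uv wz by auto
    moreover have "f ` e1 = f ` e2"
      using eq f(3) by (metis (no_types, lifting) image_cong image_image)
    ultimately show False using f(2) uv wz by auto
  qed
  have two: "card (\<phi> ` e') = 2" if e': "e' \<in> F - {e}" for e'
  proof -
    obtain u v where uv: "e' = {u, v}" using e' pair by blast
    obtain f where f: "compatible (F - {{u, v}}) f" "f u \<noteq> f v" "\<forall>z. f (\<phi> z) = f z"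
      using fac e' uv by blast
    then have "\<phi> u \<noteq> \<phi> v" by metis
    then show ?thesis using uv by simp
  qed
  have "separated F'"
    unfolding separated_def
  proof (intro allI impI)
    fix x' y' assume "{x', y'} \<in> F'"
    then obtain e1 where e1: "e1 \<in> F - {e}" "{x', y'} = \<phi> ` e1" unfolding F'_def by blast
    obtain u v where uv: "e1 = {u, v}" using e1(1) pair by blast
    obtain f where f: "compatible (F - {{u, v}}) f" "f u \<noteq> f v" "\<forall>z. f (\<phi> z) = f z"
      using fac e1(1) uv by blast
    have "compatible (F' - {{x', y'}}) f"
      unfolding compatible_def
    proof (intro allI impI)
      fix p q assume pq: "{p, q} \<in> F' - {{x', y'}}"
      then obtain e2 where e2: "e2 \<in> F - {e}" "{p, q} = \<phi> ` e2" unfolding F'_def by blast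
      obtain w z where wz: "e2 = {w, z}" using e2(1) pair by blast
      have "e2 \<noteq> e1" using pq e1 e2 by auto
      then have "f w = f z" using compatibleD[OF f(1), of w z] e2 uv wz by auto
      moreover have "{f p, f q} = {f w, f z}"
        using arg_cong[OF e2(2), of "image f"] wz f(3) by simp
      ultimately show "f p = f q" by auto
    qed
    moreover have "{f x', f y'} = {f u, f v}"
      using arg_cong[OF e1(2), of "image f"] uv f(3) by simp
    then have "f x' \<noteq> f y'" using f(2) by auto
    ultimately show "\<exists>f. compatible (F' - {{x', y'}}) f \<and> f x' \<noteq> f y'" by blast
  qed
  moreover have "card F' = n"
    unfolding F'_def using card_image[OF inj] Suc.hyps(2) e Suc.prems(2) by simp
  moreover have "\<Union>F' \<subseteq> W - {y}"
    using Suc.prems(5) xyW xy unfolding F'_def \<phi>_def by auto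
  moreover have "finite F'" using Suc.prems(2) unfolding F'_def by simp
  moreover have "W - {y} \<noteq> {}" using xyW xy by auto
  moreover have "\<forall>e\<in>F'. card e = 2" using two unfolding F'_def by auto
  ultimately have "Suc n \<le> card (W - {y})"
    using Suc.hyps(1)[of F' "W - {y}"] Suc.prems(1) by simp
  moreover have "card (W - {y}) + 1 = card W"
    using Suc.prems(1) xyW by (metis Suc_eq_plus1 card_Suc_Diff1)
  ultimately show ?case using Suc.hyps(2) by linarith
qed

text \<open>Conversely, the indicator of the set of vertices reachable from \<open>v\<close> is a
  test function, since edges can be traversed in both directions.\<close>

lemma connected_graph_iff_connects: "connected_graph F \<longleftrightarrow> connects UNIV F"
proof
  assume c: "connected_graph F"
  have "f x = f y" if f: "compatible F f" for f x y
  proof -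
    have "(x, y) \<in> {(x, y). {x, y} \<in> F}\<^sup>*" using c by (auto simp: connected_graph_def)
    then show ?thesis by induction (use compatibleD[OF f] in auto)
  qed
  then show "connects UNIV F" by (auto simp: connects_def)
next
  assume c: "connects UNIV F"
  show "connected_graph F"
    unfolding connected_graph_def
  proof (intro allI)
    fix v w
    let ?R = "{(x, y). {x, y} \<in> F}"
    define f :: "'a \<Rightarrow> real" where "f x = (if (v, x) \<in> ?R\<^sup>* then 1 else 0)" for x
    have step: "(v, y) \<in> ?R\<^sup>*" if "{x, y} \<in> F" "(v, x) \<in> ?R\<^sup>*" for x y
      using that by (auto intro: rtrancl_into_rtrancl)
    have "compatible F f"
      unfolding compatible_def
    proof (intro allI impI)
      fix x y assume xy: "{x, y} \<in> F"
      then have "{y, x} \<in> F" by (simp add: insert_commute)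
      with step[OF xy] step[of y x] show "f x = f y" unfolding f_def by auto
    qed
    from connectsD[OF c this, of v w] show "(v, w) \<in> ?R\<^sup>*"
      by (auto simp: f_def split: if_splits)
  qed
qed

text \<open>When the next vertex already lies on the path, the path is cut back to that occurrence;
  otherwise it is appended.\<close>

lemma rtrancl_distinct_path:
  assumes "(x, y) \<in> R\<^sup>*"
  shows "\<exists>c. c \<noteq> [] \<and> distinct c \<and> hd c = x \<and> last c = y \<and>
    (\<forall>i. Suc i < length c \<longrightarrow> (c ! i, c ! Suc i) \<in> R)"
  using assms
proof induction
  case base
  show ?case by (rule exI[of _ "[x]"]) simp
next
  case (step y z)
  then obtain c where c: "c \<noteq> []" "distinct c" "hd c = x" "last c = y"
    "\<And>i. Suc i < length c \<Longrightarrow> (c ! i, c ! Suc i) \<in> R" by blast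
  show ?case
  proof (cases "z \<in> set c")
    case True
    then obtain i where i: "i < length c" "c ! i = z" by (metis in_set_conv_nth)
    show ?thesis
    proof (rule exI[of _ "take (Suc i) c"], intro conjI allI impI)
      show "hd (take (Suc i) c) = x" using c by simp
      show "last (take (Suc i) c) = z" using i by (simp add: take_Suc_conv_app_nth)
    qed (use c i in auto)
  next
    case False
    show ?thesis
    proof (rule exI[of _ "c @ [z]"], intro conjI allI impI)
      fix i assume i: "Suc i < length (c @ [z])"
      show "((c @ [z]) ! i, (c @ [z]) ! Suc i) \<in> R"
      proof (cases "Suc i = length c")
        case True
        then have "i = length c - 1" "i < length c" by simp_all
        then have "c ! i = y" using c(1,4) by (simp add: last_conv_nth)
        then show ?thesis using True step.hyps(2) \<open>i < length c\<close> by (simp add: nth_append)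
      next
        case False
        then show ?thesis
          using c(5)[of i] i by (simp add: nth_append)
      qed
    qed (use c False in auto)
  qed
qed

text \<open>A cycle exists exactly if some edge is superfluous for connectivity.\<close>

lemma spanning_tree_iff_connects:
  assumes "simple_graph T"
  shows "spanning_tree T E \<longleftrightarrow>
    T \<subseteq> E \<and> connects UNIV T \<and> (\<forall>e\<in>T. \<not> connects UNIV (T - {e}))"
proof -
  have "(\<exists>c. graph_cycle T c) \<longleftrightarrow> (\<exists>e\<in>T. connects UNIV (T - {e}))" if conn: "connects UNIV T"
  proof
    assume "\<exists>c. graph_cycle T c"
    then obtain c where c: "3 \<le> length c" "distinct c"
      "\<And>i. Suc i < length c \<Longrightarrow> {c ! i, c ! Suc i} \<in> T" "{last c, hd c} \<in> T"
      by (auto simp: graph_cycle_def)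
    let ?e = "{last c, hd c}"
    have ne: "c \<noteq> []" using c(1) by auto
    have hl: "hd c = c ! 0" "last c = c ! (length c - 1)"
      using ne by (simp_all add: hd_conv_nth last_conv_nth)
    \<comment> \<open>With at least three vertices the closing edge differs from all edges between
      consecutive entries, so the rest of the cycle survives its deletion and still joins its
      ends.\<close>
    have edge: "{c ! i, c ! Suc i} \<in> T - {?e}" if i: "Suc i < length c" for i
    proof -
      have "{c ! i, c ! Suc i} \<noteq> ?e"
      proof
        assume "{c ! i, c ! Suc i} = ?e"
        moreover have "i < length c" "0 < length c" "length c - 1 < length c" using i by auto
        ultimately have "i = length c - 1 \<and> Suc i = 0 \<or> i = 0 \<and> Suc i = length c - 1"
          unfolding hl doubleton_eq_iff using i by (simp add: nth_eq_iff_index_eq[OF c(2)])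
        then show False using c(1) by auto
      qed
      then show ?thesis using c(3)[OF i] by simp
    qed
    have "compatible T f" if f: "compatible (T - {?e}) f" for f
    proof -
      have *: "i < length c \<Longrightarrow> f (c ! i) = f (c ! 0)" for i
      proof (induction i)
        case (Suc i)
        then show ?case using compatibleD[OF f edge] by (metis Suc_lessD)
      qed simp
      have "f (last c) = f (hd c)" using *[of "length c - 1"] ne unfolding hl by simp
      then show ?thesis using f by (rule compatible_Diff_edge[rotated])
    qed
    then have "connects UNIV (T - {?e})" by (intro connectsI connectsD[OF conn])
    then show "\<exists>e\<in>T. connects UNIV (T - {e})" using c(4) by blast
  next
    assume "\<exists>e\<in>T. connects UNIV (T - {e})"
    then obtain e where e: "e \<in> T" "connected_graph (T - {e})"
      by (auto simp: connected_graph_iff_connects)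
    then have "card e = 2" using assms by (auto simp: simple_graph_def)
    then obtain x y where xy: "e = {x, y}" "x \<noteq> y" by (meson card_2_iff)
    obtain c where c: "c \<noteq> []" "distinct c" "hd c = x" "last c = y"
      "\<And>i. Suc i < length c \<Longrightarrow> {c ! i, c ! Suc i} \<in> T - {e}"
      using e(2) rtrancl_distinct_path[of x y "{(x, y). {x, y} \<in> T - {e}}"]
      unfolding connected_graph_def by auto
    have hl: "x = c ! 0" "y = c ! (length c - 1)"
      using hd_conv_nth[OF c(1)] last_conv_nth[OF c(1)] c(3,4) by simp_all
    \<comment> \<open>A path with two vertices would be the deleted edge \<open>e\<close> itself;
      this leaves at least three, as a cycle demands.\<close>
    have "length c \<noteq> 1" "length c \<noteq> 0" using hl xy c(1) by auto
    moreover have "length c \<noteq> 2" using hl xy c(5)[of 0] by auto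
    ultimately have "3 \<le> length c" by linarith
    then have "graph_cycle T c"
      unfolding graph_cycle_def using c e xy by (auto simp: insert_commute)
    then show "\<exists>c. graph_cycle T c" ..
  qed
  then show ?thesis
    by (auto simp: spanning_tree_def connected_graph_iff_connects)
qed

text \<open>A function that witnesses disconnection after deleting an edge must differ at its ends;
  otherwise it would be compatible with all of \<open>T\<close> and therefore constant.\<close>

lemma minimally_connects_separated:
  assumes "connects UNIV T" "\<forall>e\<in>T. \<not> connects UNIV (T - {e})"
  shows "separated T"
  unfolding separated_def
proof (intro allI impI)
  fix x y assume xy: "{x, y} \<in> T"
  then have "\<not> connects UNIV (T - {{x, y}})" using assms(2) by simp
  then obtain f u v where f: "compatible (T - {{x, y}}) f" "f u \<noteq> f v"
    by (auto simp: connects_def)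
  have "f x \<noteq> f y"
  proof
    assume eq: "f x = f y"
    have "compatible T f" using compatible_Diff_edge[OF f(1) eq] .
    then show False using connectsD[OF assms(1), of f u v] f(2) by simp
  qed
  then show "\<exists>f. compatible (T - {{x, y}}) f \<and> f x \<noteq> f y" using f(1) by blast
qed

section \<open>Tight graphs\<close>

text \<open>The vertex set is explicit because the induction changes it. Only induced subgraphs are
  tested, as they have the most edges on a given vertex set, and \<open>+ 2\<close> on the left
  avoids subtraction of natural numbers.\<close>

definition tight :: "'v set \<Rightarrow> 'v set set \<Rightarrow> bool" where
  "tight V E \<longleftrightarrow> finite V \<and> V \<noteq> {} \<and> (\<forall>e\<in>E. card e = 2 \<and> e \<subseteq> V) \<and>
     card E + 2 = 2 * card V \<and> (\<forall>X\<subseteq>V. X \<noteq> {} \<longrightarrow> card {e \<in> E. e \<subseteq> X} + 2 \<le> 2 * card X)"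

lemma tightD:
  assumes "tight V E"
  shows "finite V" "V \<noteq> {}" "e \<in> E \<Longrightarrow> card e = 2" "e \<in> E \<Longrightarrow> e \<subseteq> V"
    "card E + 2 = 2 * card V"
    "X \<subseteq> V \<Longrightarrow> X \<noteq> {} \<Longrightarrow> card {e \<in> E. e \<subseteq> X} + 2 \<le> 2 * card X"
  using assms by (auto simp: tight_def)

lemma tight_finite_edges:
  assumes "tight V E"
  shows "finite E"
proof (rule finite_subset)
  show "E \<subseteq> Pow V" using tightD(4)[OF assms] by auto
  show "finite (Pow V)" using tightD(1)[OF assms] by simp
qed

lemma tight_edge_pair:
  assumes "tight V E" "e \<in> E"
  shows "\<exists>x y. e = {x, y} \<and> x \<noteq> y \<and> x \<in> V \<and> y \<in> V"
proof -
  obtain x y where "e = {x, y}" "x \<noteq> y"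
    using tightD(3)[OF assms] by (meson card_2_iff)
  then show ?thesis using tightD(4)[OF assms] by auto
qed

lemma tight_induced:
  assumes t: "tight V E" and X: "X \<subseteq> V" "X \<noteq> {}" "card {e \<in> E. e \<subseteq> X} + 2 = 2 * card X"
  shows "tight X {e \<in> E. e \<subseteq> X}"
  unfolding tight_def
proof (intro conjI allI impI ballI)
  show "finite X" using tightD(1)[OF t] X(1) finite_subset by blast
  fix Y assume Y: "Y \<subseteq> X" "Y \<noteq> {}"
  then have "{e \<in> {e \<in> E. e \<subseteq> X}. e \<subseteq> Y} = {e \<in> E. e \<subseteq> Y}" by auto
  then show "card {e \<in> {e \<in> E. e \<subseteq> X}. e \<subseteq> Y} + 2 \<le> 2 * card Y"
    using tightD(6)[OF t, of Y] Y X(1) by simp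
qed (use X tightD(3)[OF t] in auto)

lemma tight_degree_sum:
  assumes "tight V E" "v \<in> V"
  shows "card E = card {e \<in> E. e \<subseteq> V - {v}} + card {e \<in> E. v \<in> e}"
proof -
  have "E = {e \<in> E. e \<subseteq> V - {v}} \<union> {e \<in> E. v \<in> e}"
    using tightD(4)[OF assms(1)] by auto
  moreover have "{e \<in> E. e \<subseteq> V - {v}} \<inter> {e \<in> E. v \<in> e} = {}" by auto
  ultimately show ?thesis
    using tight_finite_edges[OF assms(1)] card_Un_disjoint
    by (metis (no_types, lifting) finite_Un)
qed

lemma tight_degree:
  assumes "tight V E" "v \<in> V"
  shows "card {e \<in> E. v \<in> e} = card {x. {v, x} \<in> E}"
proof -
  have "{e \<in> E. v \<in> e} = (\<lambda>x. {v, x}) ` {x. {v, x} \<in> E}"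
  proof (intro equalityI subsetI)
    fix e assume e: "e \<in> {e \<in> E. v \<in> e}"
    then obtain x y where xy: "e = {x, y}" using tight_edge_pair[OF assms(1)] by blast
    with e have "e = {v, x} \<or> e = {v, y}" by auto
    with e show "e \<in> (\<lambda>x. {v, x}) ` {x. {v, x} \<in> E}" by auto
  qed auto
  moreover have "inj_on (\<lambda>x. {v, x}) {x. {v, x} \<in> E}"
    by (auto simp: inj_on_def doubleton_eq_iff)
  ultimately show ?thesis by (simp add: card_image)
qed

lemma tight_neighbour:
  assumes "tight V E" "{v, x} \<in> E"
  shows "x \<in> V" "x \<noteq> v"
  using tightD(3,4)[OF assms] by auto

text \<open>With \<open>n\<close> vertices, the other \<open>n - 1\<close> span at most
  \<open>2 * n - 4\<close> of the \<open>2 * n - 2\<close> edges.\<close>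

lemma tight_min_degree:
  assumes t: "tight V E" and v: "v \<in> V" and "card V \<noteq> 1"
  shows "2 \<le> card {e \<in> E. v \<in> e}"
proof -
  have c: "card (V - {v}) + 1 = card V"
    using tightD(1)[OF t] v by (metis Suc_eq_plus1 card_Suc_Diff1)
  then have "V - {v} \<noteq> {}" using assms(3) by force
  then have "card {e \<in> E. e \<subseteq> V - {v}} + 2 \<le> 2 * card (V - {v})"
    by (intro tightD(6)[OF t]) auto
  then show ?thesis using c tightD(5)[OF t] tight_degree_sum[OF t v] by linarith
qed

text \<open>The degrees sum to \<open>2 * card E = 4 * card V - 4\<close>, which is less than four
  per vertex.\<close>

lemma tight_small_degree:
  assumes t: "tight V E"
  shows "\<exists>v\<in>V. card {e \<in> E. v \<in> e} \<le> 3"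
proof (rule ccontr)
  assume "\<not> ?thesis"
  then have "(\<Sum>v\<in>V. 4) \<le> (\<Sum>v\<in>V. card {e \<in> E. v \<in> e})"
    by (intro sum_mono) force
  also have "(\<Sum>v\<in>V. card {e \<in> E. v \<in> e}) = 2 * card E"
  proof (rule sum_multicount[OF tightD(1)[OF t] tight_finite_edges[OF t]], intro ballI)
    fix e assume e: "e \<in> E"
    then have "{v \<in> V. v \<in> e} = e" using tightD(4)[OF t] by auto
    then show "card {v \<in> V. v \<in> e} = 2" using tightD(3)[OF t e] by simp
  qed
  finally show False using tightD(5)[OF t] by simp
qed

text \<open>The contraction loses \<open>card H - 1\<close> vertices and the
  \<open>2 * card H - 2\<close> edges inside \<open>H\<close>, so the count stays tight provided
  that no edges merge; \<open>uniq\<close> guarantees this.\<close>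

lemma tight_contract:
  fixes V :: "'v set"
  assumes t: "tight V E" and H: "H \<subseteq> V" "h \<in> H" "card {e \<in> E. e \<subseteq> H} + 2 = 2 * card H"
    and uniq: "\<And>w x x'. w \<in> V - H \<Longrightarrow> x \<in> H \<Longrightarrow> x' \<in> H \<Longrightarrow> {w, x} \<in> E \<Longrightarrow> {w, x'} \<in> E \<Longrightarrow> x = x'"
  defines "\<phi> \<equiv> \<lambda>z. if z \<in> H then h else z"
  shows "tight (insert h (V - H)) ((\<lambda>e. \<phi> ` e) ` {e \<in> E. \<not> e \<subseteq> H})"
proof -
  let ?F = "{e \<in> E. \<not> e \<subseteq> H}" and ?V = "insert h (V - H)"
  let ?E = "(\<lambda>e. \<phi> ` e) ` ?F"
  have finE: "finite E" using tight_finite_edges[OF t] .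
  have finV: "finite V" and finH: "finite H"
    using tightD(1)[OF t] H(1) finite_subset by auto
  have edge: "\<exists>x y. e = {x, y} \<and> x \<noteq> y \<and> x \<in> V \<and> y \<in> V \<and> y \<notin> H" if e: "e \<in> ?F" for e
  proof -
    have "e \<in> E" using e by simp
    then obtain x y where "e = {x, y}" "x \<noteq> y" "x \<in> V" "y \<in> V"
      using tight_edge_pair[OF t] by blast
    then show ?thesis using e by (cases "y \<in> H") (auto simp: insert_commute)
  qed
  have inj: "inj_on (\<lambda>e. \<phi> ` e) ?F"
  proof (rule inj_onI)
    fix e1 e2 assume e1: "e1 \<in> ?F" and e2: "e2 \<in> ?F" and eq: "\<phi> ` e1 = \<phi> ` e2"
    obtain x1 y1 where 1: "e1 = {x1, y1}" "x1 \<noteq> y1" "x1 \<in> V" "y1 \<in> V" "y1 \<notin> H"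
      using edge[OF e1] by blast
    obtain x2 y2 where 2: "e2 = {x2, y2}" "x2 \<noteq> y2" "x2 \<in> V" "y2 \<in> V" "y2 \<notin> H"
      using edge[OF e2] by blast
    have eq': "{\<phi> x1, y1} = {\<phi> x2, y2}" 
    proof -
      have "\<phi> y1 = y1" "\<phi> y2 = y2" using 1 2 by (simp_all add: \<phi>_def)
      then show ?thesis using eq unfolding 1(1) 2(1) by simp
    qed
    \<comment> \<open>Two edges can only collide if each has an end in \<open>H\<close> and they
      share the other end; this is the case excluded by \<open>uniq\<close>.\<close>
    consider (both) "x1 \<in> H" "x2 \<in> H" | "x1 \<in> H" "x2 \<notin> H" | "x1 \<notin> H" "x2 \<in> H" | "x1 \<notin> H" "x2 \<notin> H"
      by blast
    then show "e1 = e2"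
    proof cases
      case both
      then have "y1 = y2" using eq' 1 2 H(2) both by (auto simp: \<phi>_def doubleton_eq_iff)
      moreover have "x1 = x2"
        by (rule uniq[of y1]) (use 1 2 both e1 e2 \<open>y1 = y2\<close> in \<open>auto simp: insert_commute\<close>)
      ultimately show ?thesis using 1 2 by simp
    qed (use eq' 1 2 H(2) in \<open>auto simp: \<phi>_def doubleton_eq_iff\<close>)
  qed
  have cE: "card ?F + card {e \<in> E. e \<subseteq> H} = card E"
  proof -
    have "card (?F \<union> {e \<in> E. e \<subseteq> H}) = card ?F + card {e \<in> E. e \<subseteq> H}"
      by (rule card_Un_disjoint) (use finE in auto)
    moreover have "?F \<union> {e \<in> E. e \<subseteq> H} = E" by auto
    ultimately show ?thesis by simp
  qed
  have cV: "card ?V + card H = card V + 1"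
  proof -
    have "card (V - H) = card V - card H" "card H \<le> card V"
      using card_Diff_subset[OF finH H(1)] card_mono[OF finV H(1)] by auto
    then show ?thesis using finV H(2) by simp
  qed
  show ?thesis
    unfolding tight_def
  proof (intro conjI allI impI ballI)
    show "finite ?V" "?V \<noteq> {}" using finV by auto
    show "card ?E + 2 = 2 * card ?V"
      using card_image[OF inj] cE cV tightD(5)[OF t] H(3) by linarith
    fix e' assume "e' \<in> ?E"
    then obtain e where e: "e \<in> ?F" "e' = \<phi> ` e" by blast
    then obtain x y where xy: "e = {x, y}" "x \<noteq> y" "x \<in> V" "y \<in> V" "y \<notin> H"
      using edge by blast
    then have "e' = {\<phi> x, y}" "\<phi> x \<noteq> y" using e(2) H(2) by (auto simp: \<phi>_def)
    then show "card e' = 2" "e' \<subseteq> ?V" using xy by (auto simp: \<phi>_def)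
  next
    fix X assume X: "X \<subseteq> ?V" "X \<noteq> {}"
    show "card {e \<in> ?E. e \<subseteq> X} + 2 \<le> 2 * card X"
    proof (cases "h \<in> X")
      case True
      \<comment> \<open>A set containing \<open>h\<close> is pulled back to
        \<open>X \<union> H\<close>. Sparsity there, minus the exact edge count of \<open>H\<close>,
        is the required bound.\<close>
      let ?G = "{e \<in> ?F. e \<subseteq> X \<union> H}"
      have "{e \<in> ?E. e \<subseteq> X} \<subseteq> (\<lambda>e. \<phi> ` e) ` ?G"
      proof
        fix e' assume "e' \<in> {e \<in> ?E. e \<subseteq> X}"
        then obtain e where e: "e \<in> ?F" "e' = \<phi> ` e" "\<phi> ` e \<subseteq> X" by blast
        have "z \<in> X \<union> H" if "z \<in> e" for z
          using e(3) that by (cases "z \<in> H") (auto simp: \<phi>_def)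
        then show "e' \<in> (\<lambda>e. \<phi> ` e) ` ?G" using e(1,2) by blast
      qed
      moreover have finG: "finite ?G" using finE by simp
      ultimately have "card {e \<in> ?E. e \<subseteq> X} \<le> card ((\<lambda>e. \<phi> ` e) ` ?G)"
        by (intro card_mono) auto
      then have "card {e \<in> ?E. e \<subseteq> X} \<le> card ?G"
        using card_image_le[OF finG, of "\<lambda>e. \<phi> ` e"] by linarith
      moreover have "card (?G \<union> {e \<in> E. e \<subseteq> H}) = card ?G + card {e \<in> E. e \<subseteq> H}"
        by (rule card_Un_disjoint) (use finE in auto)
      moreover have "?G \<union> {e \<in> E. e \<subseteq> H} = {e \<in> E. e \<subseteq> X \<union> H}" by auto
      moreover have "card {e \<in> E. e \<subseteq> X \<union> H} + 2 \<le> 2 * card (X \<union> H)"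
        by (rule tightD(6)[OF t]) (use X H in auto)
      moreover have "card (X \<union> H) + 1 = card X + card H"
      proof -
        have "X \<inter> H = {h}" using X(1) True H(2) by auto
        then show ?thesis
          using card_Un_Int[of X H] finH finite_subset[OF X(1)] finV by simp
      qed
      ultimately show ?thesis using H(3) by simp
    next
      case False
      have "{e \<in> ?E. e \<subseteq> X} \<subseteq> {e \<in> E. e \<subseteq> X}"
      proof
        fix e' assume "e' \<in> {e \<in> ?E. e \<subseteq> X}"
        then obtain e where e: "e \<in> E" "e' = \<phi> ` e" "\<phi> ` e \<subseteq> X" by blast
        have "z \<notin> H" if "z \<in> e" for z
          using e(3) that False by (auto simp: \<phi>_def)
        then have "\<phi> ` e = e" by (force simp: \<phi>_def)
        then show "e' \<in> {e \<in> E. e \<subseteq> X}" using e by simp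
      qed
      then have "card {e \<in> ?E. e \<subseteq> X} \<le> card {e \<in> E. e \<subseteq> X}"
        using finE by (intro card_mono) auto
      moreover have "X \<subseteq> V" using X(1) False by auto
      then have "card {e \<in> E. e \<subseteq> X} + 2 \<le> 2 * card X"
        using tightD(6)[OF t] X(2) by blast
      ultimately show ?thesis by linarith
    qed
  qed
qed

section \<open>Colourings by pairs of linear orders\<close>

text \<open>A positive product says that \<open>s\<close> and \<open>t\<close> order the ends in the
  same way; it does not change when the ends are swapped, so it is a property of the unordered
  edge.\<close>

definition concordant :: "'v set set \<Rightarrow> ('v \<Rightarrow> real) \<Rightarrow> ('v \<Rightarrow> real) \<Rightarrow> 'v set set" where
  "concordant E s t = {e \<in> E. \<exists>x y. e = {x, y} \<and> 0 < (s x - s y) * (t x - t y)}"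

lemma concordant_iff:
  "{x, y} \<in> concordant E s t \<longleftrightarrow> {x, y} \<in> E \<and> 0 < (s x - s y) * (t x - t y)"
proof
  assume "{x, y} \<in> concordant E s t"
  then obtain u v where uv: "{x, y} = {u, v}" "0 < (s u - s v) * (t u - t v)" "{x, y} \<in> E"
    by (auto simp: concordant_def)
  have "(s v - s u) * (t v - t u) = (s u - s v) * (t u - t v)" by algebra
  then show "{x, y} \<in> E \<and> 0 < (s x - s y) * (t x - t y)"
    using uv by (auto simp: doubleton_eq_iff)
qed (auto simp: concordant_def)

lemma concordant_subset:
  assumes "F \<subseteq> E" "\<And>e x. e \<in> F \<Longrightarrow> x \<in> e \<Longrightarrow> s' x = s x \<and> t' x = t x"
  shows "concordant F s t \<subseteq> concordant E s' t'"
proof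
  fix e assume "e \<in> concordant F s t"
  then obtain x y where xy: "e = {x, y}" "e \<in> F" "0 < (s x - s y) * (t x - t y)"
    by (auto simp: concordant_def)
  then have "s' x = s x" "t' x = t x" "s' y = s y" "t' y = t y"
    using assms(2)[of e x] assms(2)[of e y] by auto
  then have "{x, y} \<in> concordant E s' t'"
    unfolding concordant_iff using xy assms(1) by auto
  then show "e \<in> concordant E s' t'" using xy(1) by simp
qed

text \<open>
  Negating \<open>t\<close> turns discordant edges into concordant ones.
\<close>

definition connecting_orders :: "'v set \<Rightarrow> 'v set set \<Rightarrow> ('v \<Rightarrow> real) \<Rightarrow> ('v \<Rightarrow> real) \<Rightarrow> bool" where
  "connecting_orders V E s t \<longleftrightarrow> inj_on s V \<and> inj_on t V \<and>
     connects V (concordant E s t) \<and> connects V (concordant E s (\<lambda>x. - t x))"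

lemma connecting_orders_flip:
  "connecting_orders V E s t \<Longrightarrow> connecting_orders V E s (\<lambda>x. - t x)"
  by (auto simp: connecting_orders_def inj_on_def)

section \<open>Placing a new vertex relative to two or three old ones\<close>

lemma finite_avoid:
  fixes l u :: real
  assumes "finite A" "l < u"
  shows "\<exists>x. l < x \<and> x < u \<and> x \<notin> A"
proof -
  have "infinite ({l<..<u} - A)" using assms infinite_Ioo by simp
  then have "{l<..<u} - A \<noteq> {}" by (metis finite.emptyI)
  then show ?thesis by auto
qed

lemma finite_avoid_above:
  fixes l :: real
  assumes "finite A"
  shows "\<exists>x. l < x \<and> l' < x \<and> x \<notin> A"
  using finite_avoid[OF assms, of "max l l'" "max l l' + 1"] by auto

lemma finite_avoid_below:
  fixes l :: real
  assumes "finite A"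
  shows "\<exists>x. x < l \<and> x < l' \<and> x \<notin> A"
proof -
  have "min l l' - 1 < min l l'" by linarith
  from finite_avoid[OF assms this] show ?thesis by auto
qed

text \<open>The new point is put into the horizontal strip between the two given points, far to the
  right if \<open>a\<close> is the lower one and far to the left otherwise. The sets
  \<open>A\<close> and \<open>B\<close> will be the values already taken, so that the orders stay
  injective.\<close>

lemma place_two:
  fixes a1 a2 b1 b2 :: real
  assumes fin: "finite A" "finite B" and ne: "a2 \<noteq> b2"
  shows "\<exists>x y. x \<notin> A \<and> y \<notin> B \<and> 0 < (x - a1) * (y - a2) \<and> (x - b1) * (y - b2) < 0"
proof (cases "a2 < b2")
  case True
  obtain x where "a1 < x" "b1 < x" "x \<notin> A" using finite_avoid_above[OF fin(1)] by blast
  moreover obtain y where "a2 < y" "y < b2" "y \<notin> B" using finite_avoid[OF fin(2) True] by blast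
  ultimately show ?thesis
    by (intro exI[of _ x] exI[of _ y]) (simp add: zero_less_mult_iff mult_less_0_iff)
next
  case False
  then have lt: "b2 < a2" using ne by simp
  obtain x where "x < a1" "x < b1" "x \<notin> A" using finite_avoid_below[OF fin(1)] by blast
  moreover obtain y where "b2 < y" "y < a2" "y \<notin> B" using finite_avoid[OF fin(2) lt] by blast
  ultimately show ?thesis
    by (intro exI[of _ x] exI[of _ y]) (simp add: zero_less_mult_iff mult_less_0_iff)
qed

text \<open>Consider the box with lower left corner \<open>a\<close> and upper right corner
  \<open>b\<close>. If \<open>c\<close> exceeds the box on some side, the new point goes beyond that
  side but not past \<open>c\<close> in this coordinate, and past everything in the other. If
  \<open>c\<close> is inside, the new point goes into the box, to the upper left of
  \<open>c\<close>.\<close>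

lemma place_three_ordered:
  fixes a1 a2 b1 b2 c1 c2 :: real
  assumes fin: "finite A" "finite B"
    and ab: "a1 < b1" "a2 < b2" and c: "c1 \<noteq> a1" "c1 \<noteq> b1" "c2 \<noteq> a2" "c2 \<noteq> b2"
  shows "\<exists>x y. x \<notin> A \<and> y \<notin> B \<and> 0 < (x - a1) * (y - a2) \<and> 0 < (x - b1) * (y - b2) \<and>
    (x - c1) * (y - c2) < 0"
proof -
  consider "b2 < c2" | "b1 < c1" | "c2 < a2" | "c1 < a1" | "a1 < c1" "c1 < b1" "a2 < c2" "c2 < b2"
    using c by linarith
  then show ?thesis
  proof cases
    case 1
    obtain x where "b1 < x" "c1 < x" "x \<notin> A" using finite_avoid_above[OF fin(1)] by blast
    moreover obtain y where "b2 < y" "y < c2" "y \<notin> B" using finite_avoid[OF fin(2) 1] by blast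
    ultimately show ?thesis using ab
      by (intro exI[of _ x] exI[of _ y]) (simp add: zero_less_mult_iff mult_less_0_iff)
  next
    case 2
    obtain y where "b2 < y" "c2 < y" "y \<notin> B" using finite_avoid_above[OF fin(2)] by blast
    moreover obtain x where "b1 < x" "x < c1" "x \<notin> A" using finite_avoid[OF fin(1) 2] by blast
    ultimately show ?thesis using ab
      by (intro exI[of _ x] exI[of _ y]) (simp add: zero_less_mult_iff mult_less_0_iff)
  next
    case 3
    obtain x where "x < a1" "x < c1" "x \<notin> A" using finite_avoid_below[OF fin(1)] by blast
    moreover obtain y where "c2 < y" "y < a2" "y \<notin> B" using finite_avoid[OF fin(2) 3] by blast
    ultimately show ?thesis using ab
      by (intro exI[of _ x] exI[of _ y]) (simp add: zero_less_mult_iff mult_less_0_iff)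
  next
    case 4
    obtain y where "y < a2" "y < c2" "y \<notin> B" using finite_avoid_below[OF fin(2)] by blast
    moreover obtain x where "c1 < x" "x < a1" "x \<notin> A" using finite_avoid[OF fin(1) 4] by blast
    ultimately show ?thesis using ab
      by (intro exI[of _ x] exI[of _ y]) (simp add: zero_less_mult_iff mult_less_0_iff)
  next
    case 5
    obtain x where "a1 < x" "x < c1" "x \<notin> A" using finite_avoid[OF fin(1) 5(1)] by blast
    moreover obtain y where "c2 < y" "y < b2" "y \<notin> B" using finite_avoid[OF fin(2) 5(4)] by blast
    ultimately show ?thesis using 5
      by (intro exI[of _ x] exI[of _ y]) (simp add: zero_less_mult_iff mult_less_0_iff)
  qed
qed

lemma place_three:
  fixes a1 a2 b1 b2 c1 c2 :: real
  assumes fin: "finite A" "finite B"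
    and ab: "0 < (a1 - b1) * (a2 - b2)" and c: "c1 \<noteq> a1" "c1 \<noteq> b1" "c2 \<noteq> a2" "c2 \<noteq> b2"
  shows "\<exists>x y. x \<notin> A \<and> y \<notin> B \<and> 0 < (x - a1) * (y - a2) \<and> 0 < (x - b1) * (y - b2) \<and>
    (x - c1) * (y - c2) < 0"
proof (cases "a1 < b1")
  case True
  then have "a2 < b2" using ab by (auto simp: zero_less_mult_iff)
  from place_three_ordered[OF fin True this c] show ?thesis .
next
  case False
  then have "b1 < a1" "b2 < a2" using ab by (auto simp: zero_less_mult_iff)
  from place_three_ordered[OF fin this c(2,1,4,3)] show ?thesis by blast
qed

text \<open>The new vertex becomes a leaf of both classes: it is attached to \<open>a\<close> by a
  concordant edge and to \<open>b\<close> by a discordant one.\<close>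

lemma connecting_orders_extend_two:
  assumes o: "connecting_orders V F s t" and "finite V" "v \<notin> V"
    and F: "F \<subseteq> E" "\<And>e. e \<in> F \<Longrightarrow> e \<subseteq> V"
    and ab: "a \<in> V" "b \<in> V" "a \<noteq> b" "{v, a} \<in> E" "{v, b} \<in> E"
  shows "\<exists>s t. connecting_orders (insert v V) E s t"
proof -
  have inj: "inj_on s V" "inj_on t V" using o by (auto simp: connecting_orders_def)
  then have "t a \<noteq> t b" using ab by (auto simp: inj_on_def)
  then obtain x y where xy: "x \<notin> s ` V" "y \<notin> t ` V" "0 < (x - s a) * (y - t a)"
    "(x - s b) * (y - t b) < 0"
    using place_two[of "s ` V" "t ` V" "t a" "t b" "s a" "s b"] \<open>finite V\<close> by auto
  let ?s = "s(v := x)" and ?t = "t(v := y)"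
  have ne: "v \<noteq> a" "v \<noteq> b" using ab \<open>v \<notin> V\<close> by auto
  have fresh: "z \<noteq> v" if "e \<in> F" "z \<in> e" for e z
    using F(2)[OF that(1)] that(2) \<open>v \<notin> V\<close> by auto
  have "connects (insert v V) (concordant E ?s ?t)"
  proof (rule connects_insert)
    show "connects V (concordant F s t)" using o by (simp add: connecting_orders_def)
    show "concordant F s t \<subseteq> concordant E ?s ?t"
      by (rule concordant_subset[OF F(1)]) (use fresh in auto)
    show "{v, a} \<in> concordant E ?s ?t" using ab ne xy by (simp add: concordant_iff)
  qed (fact ab)
  moreover have "connects (insert v V) (concordant E ?s (\<lambda>x. - ?t x))"
  proof (rule connects_insert)
    show "connects V (concordant F s (\<lambda>x. - t x))" using o by (simp add: connecting_orders_def)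
    show "concordant F s (\<lambda>x. - t x) \<subseteq> concordant E ?s (\<lambda>x. - ?t x)"
      by (rule concordant_subset[OF F(1)]) (use fresh in auto)
    have "0 < (x - s b) * (- y - - t b)" using xy(4) by (simp add: algebra_simps)
    then show "{v, b} \<in> concordant E ?s (\<lambda>x. - ?t x)"
      using ab ne by (simp add: concordant_iff)
  qed (fact ab)
  moreover have "inj_on ?s (insert v V)" "inj_on ?t (insert v V)"
    using inj xy(1,2) \<open>v \<notin> V\<close> by (auto simp: inj_on_def)
  ultimately show ?thesis unfolding connecting_orders_def by blast
qed

text \<open>In the concordant class \<open>v\<close> subdivides the edge between \<open>a\<close>
  and \<open>b\<close>; in the discordant class, which does not contain that edge and so loses
  nothing with it, \<open>v\<close> is a leaf at \<open>c\<close>.\<close>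

lemma connecting_orders_extend_three_concordant:
  assumes o: "connecting_orders V (insert {a, b} F) s t" and "finite V" "v \<notin> V"
    and F: "F \<subseteq> E" "\<And>e. e \<in> F \<Longrightarrow> e \<subseteq> V"
    and abc: "a \<in> V" "b \<in> V" "c \<in> V" "a \<noteq> b" "a \<noteq> c" "b \<noteq> c"
      "{v, a} \<in> E" "{v, b} \<in> E" "{v, c} \<in> E"
    and conc: "0 < (s a - s b) * (t a - t b)"
  shows "\<exists>s t. connecting_orders (insert v V) E s t"
proof -
  have inj: "inj_on s V" "inj_on t V" using o by (auto simp: connecting_orders_def)
  then have "s c \<noteq> s a" "s c \<noteq> s b" "t c \<noteq> t a" "t c \<noteq> t b"
    using abc by (auto simp: inj_on_def)
  from place_three[OF _ _ conc this, of "s ` V" "t ` V"] \<open>finite V\<close>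
  obtain x y where xy: "x \<notin> s ` V" "y \<notin> t ` V" "0 < (x - s a) * (y - t a)"
    "0 < (x - s b) * (y - t b)" "(x - s c) * (y - t c) < 0" by auto
  let ?s = "s(v := x)" and ?t = "t(v := y)"
  have ne: "v \<noteq> a" "v \<noteq> b" "v \<noteq> c" using abc \<open>v \<notin> V\<close> by auto
  have fresh: "z \<noteq> v" if "e \<in> F" "z \<in> e" for e z
    using F(2)[OF that(1)] that(2) \<open>v \<notin> V\<close> by auto
  have "connects (insert v V) (concordant E ?s ?t)"
  proof (rule connects_subdivide)
    show "connects V (concordant (insert {a, b} F) s t)"
      using o by (simp add: connecting_orders_def)
    have "concordant (insert {a, b} F) s t - {{a, b}} \<subseteq> concordant F s t"
      by (auto simp: concordant_def)
    also have "\<dots> \<subseteq> concordant E ?s ?t"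
      by (rule concordant_subset[OF F(1)]) (use fresh in auto)
    finally show "concordant (insert {a, b} F) s t - {{a, b}} \<subseteq> concordant E ?s ?t" .
    show "{v, a} \<in> concordant E ?s ?t" "{v, b} \<in> concordant E ?s ?t"
      using abc ne xy by (simp_all add: concordant_iff)
  qed (fact abc)
  moreover have "connects (insert v V) (concordant E ?s (\<lambda>x. - ?t x))"
  proof (rule connects_insert)
    show "connects V (concordant (insert {a, b} F) s (\<lambda>x. - t x))"
      using o by (simp add: connecting_orders_def)
    have "\<not> 0 < (s a - s b) * (- t a - - t b)" using conc by (simp add: algebra_simps)
    then have "{a, b} \<notin> concordant (insert {a, b} F) s (\<lambda>x. - t x)"
      by (simp add: concordant_iff)
    then have "concordant (insert {a, b} F) s (\<lambda>x. - t x) \<subseteq> concordant F s (\<lambda>x. - t x)"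
      by (auto simp: concordant_def)
    also have "\<dots> \<subseteq> concordant E ?s (\<lambda>x. - ?t x)"
      by (rule concordant_subset[OF F(1)]) (use fresh in auto)
    finally show "concordant (insert {a, b} F) s (\<lambda>x. - t x) \<subseteq> concordant E ?s (\<lambda>x. - ?t x)" .
    have "0 < (x - s c) * (- y - - t c)" using xy(5) by (simp add: algebra_simps)
    then show "{v, c} \<in> concordant E ?s (\<lambda>x. - ?t x)"
      using abc ne by (simp add: concordant_iff)
  qed (fact abc)
  moreover have "inj_on ?s (insert v V)" "inj_on ?t (insert v V)"
    using inj xy(1,2) \<open>v \<notin> V\<close> by (auto simp: inj_on_def)
  ultimately show ?thesis unfolding connecting_orders_def by blast
qed

text \<open>If the edge between \<open>a\<close> and \<open>b\<close> is discordant, negating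
  \<open>t\<close> exchanges the two classes and reduces to the concordant case.\<close>

lemma connecting_orders_extend_three:
  assumes o: "connecting_orders V (insert {a, b} F) s t" and "finite V" "v \<notin> V"
    and F: "F \<subseteq> E" "\<And>e. e \<in> F \<Longrightarrow> e \<subseteq> V"
    and abc: "a \<in> V" "b \<in> V" "c \<in> V" "a \<noteq> b" "a \<noteq> c" "b \<noteq> c"
      "{v, a} \<in> E" "{v, b} \<in> E" "{v, c} \<in> E"
  shows "\<exists>s t. connecting_orders (insert v V) E s t"
proof (cases "0 < (s a - s b) * (t a - t b)")
  case True
  show ?thesis by (rule connecting_orders_extend_three_concordant[OF assms True])
next
  case False
  have "inj_on s V" "inj_on t V" using o by (auto simp: connecting_orders_def)
  then have "s a - s b \<noteq> 0" "t a - t b \<noteq> 0" using abc by (auto simp: inj_on_def)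
  then have "(s a - s b) * (t a - t b) \<noteq> 0" by simp
  then have "0 < (s a - s b) * (- t a - - t b)" using False by (simp add: algebra_simps)
  from connecting_orders_extend_three_concordant[OF connecting_orders_flip[OF o] assms(2-) this]
  show ?thesis .
qed

text \<open>The values come from the permutation 2, 4, 1, 3, whose inversion graph and its
  complement are both paths on four vertices: the concordant edges form the path \<open>a\<close>,
  \<open>v\<close>, \<open>c\<close>, \<open>b\<close> and the discordant ones the path
  \<open>v\<close>, \<open>b\<close>, \<open>a\<close>, \<open>c\<close>.\<close>

lemma connecting_orders_K4:
  assumes "distinct [v, a, b, c]"
    "{v, a} \<in> E" "{v, b} \<in> E" "{v, c} \<in> E" "{a, b} \<in> E" "{a, c} \<in> E" "{b, c} \<in> E"
  shows "\<exists>s t. connecting_orders {v, a, b, c} E s t"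
proof -
  define s :: "'a \<Rightarrow> real" where "s x = (if x = v then 1 else if x = a then 2 else if x = b then 3 else 4)" for x
  define t :: "'a \<Rightarrow> real" where "t x = (if x = v then 2 else if x = a then 4 else if x = b then 1 else 3)" for x
  have s: "s v = 1" "s a = 2" "s b = 3" "s c = 4" using assms(1) by (auto simp: s_def)
  have t: "t v = 2" "t a = 4" "t b = 1" "t c = 3" using assms(1) by (auto simp: t_def)
  have "connects {v, a, b, c} (concordant E s t)"
  proof (rule connectsI)
    fix f x y assume f: "compatible (concordant E s t) f"
      and xy: "x \<in> {v, a, b, c}" "y \<in> {v, a, b, c}"
    have "f v = f a" "f v = f c" "f b = f c"
      by (rule compatibleD[OF f], use assms s t in \<open>simp add: concordant_iff\<close>)+
    then show "f x = f y" using xy by auto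
  qed
  moreover have "connects {v, a, b, c} (concordant E s (\<lambda>x. - t x))"
  proof (rule connectsI)
    fix f x y assume f: "compatible (concordant E s (\<lambda>x. - t x)) f"
      and xy: "x \<in> {v, a, b, c}" "y \<in> {v, a, b, c}"
    have "f v = f b" "f a = f b" "f a = f c"
      by (rule compatibleD[OF f], use assms s t in \<open>simp add: concordant_iff\<close>)+
    then show "f x = f y" using xy by auto
  qed
  moreover have "inj_on s {v, a, b, c}" "inj_on t {v, a, b, c}"
    using s t by auto
  ultimately show ?thesis unfolding connecting_orders_def by blast
qed

text \<open>Edges inside \<open>H\<close> keep the class given by \<open>sH\<close> and
  \<open>tH\<close>, all others the class of their image in the quotient. A test function is
  therefore constant on \<open>H\<close>, descends to the quotient and is constant there.\<close>

lemma connects_blow_up: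
  fixes V H :: "'v set"
  assumes H: "H \<subseteq> V" "h \<in> H" and edge: "\<And>e. e \<in> E \<Longrightarrow> card e = 2 \<and> e \<subseteq> V"
    and \<phi>_def: "\<phi> = (\<lambda>z. if z \<in> H then h else z)"
    and cH: "connects H (concordant {e \<in> E. e \<subseteq> H} sH tH)"
    and cV: "connects (insert h (V - H)) (concordant ((\<lambda>e. \<phi> ` e) ` {e \<in> E. \<not> e \<subseteq> H}) s' t')"
    and inside: "\<And>x y. x \<in> H \<Longrightarrow> y \<in> H \<Longrightarrow> 0 < (sH x - sH y) * (tH x - tH y) \<Longrightarrow>
      0 < (s x - s y) * (t x - t y)"
    and outside: "\<And>x y. x \<in> V \<Longrightarrow> y \<in> V \<Longrightarrow> x \<noteq> y \<Longrightarrow> \<not> (x \<in> H \<and> y \<in> H) \<Longrightarrow>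
      0 < (s x - s y) * (s' (\<phi> x) - s' (\<phi> y)) \<and> 0 < (t x - t y) * (t' (\<phi> x) - t' (\<phi> y))"
  shows "connects V (concordant E s t)"
proof (rule connectsI)
  fix f u w assume f: "compatible (concordant E s t) f" and uw: "u \<in> V" "w \<in> V"
  have "compatible (concordant {e \<in> E. e \<subseteq> H} sH tH) f"
    unfolding compatible_def
  proof (intro allI impI)
    fix x y assume "{x, y} \<in> concordant {e \<in> E. e \<subseteq> H} sH tH"
    then have "{x, y} \<in> E" "x \<in> H" "y \<in> H" "0 < (sH x - sH y) * (tH x - tH y)"
      by (auto simp: concordant_iff)
    then show "f x = f y"
      using inside by (intro compatibleD[OF f]) (simp add: concordant_iff)
  qed
  then have "f x = f h" if "x \<in> H" for x
    using connectsD[OF cH _ that H(2)] by blast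
  then have f\<phi>: "f (\<phi> x) = f x" for x by (simp add: \<phi>_def)
  have "compatible (concordant ((\<lambda>e. \<phi> ` e) ` {e \<in> E. \<not> e \<subseteq> H}) s' t') f"
    unfolding compatible_def
  proof (intro allI impI)
    fix p q assume pq: "{p, q} \<in> concordant ((\<lambda>e. \<phi> ` e) ` {e \<in> E. \<not> e \<subseteq> H}) s' t'"
    then obtain e where e: "e \<in> E" "\<not> e \<subseteq> H" "{p, q} = \<phi> ` e"
      by (auto simp: concordant_iff)
    have "card e = 2" using edge[OF e(1)] by simp
    then obtain x y where xy: "e = {x, y}" "x \<noteq> y" by (meson card_2_iff)
    have V: "x \<in> V" "y \<in> V" using edge[OF e(1)] xy(1) by auto
    have im: "{p, q} = {\<phi> x, \<phi> y}" using e(3) xy by simp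
    then have "0 < (s' (\<phi> x) - s' (\<phi> y)) * (t' (\<phi> x) - t' (\<phi> y))"
      using pq unfolding im concordant_iff by simp
    moreover have "0 < (s x - s y) * (s' (\<phi> x) - s' (\<phi> y))"
      "0 < (t x - t y) * (t' (\<phi> x) - t' (\<phi> y))"
      using outside[OF V xy(2)] e(2) xy(1) by auto
    ultimately have "0 < (s x - s y) * (t x - t y)"
      by (auto simp: zero_less_mult_iff)
    then have "f x = f y"
      using e(1) xy by (intro compatibleD[OF f]) (simp add: concordant_iff)
    then have "f (\<phi> x) = f (\<phi> y)" by (simp add: f\<phi>)
    then show "f p = f q" using im by (auto simp: doubleton_eq_iff)
  qed
  then have "f (\<phi> u) = f (\<phi> w)"
    by (rule connectsD[OF cV]) (use uw in \<open>auto simp: \<phi>_def\<close>)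
  then show "f u = f w" by (simp add: f\<phi>)
qed

text \<open>Finitely many strict inequalities that hold at \<open>\<epsilon> = 0\<close> persist for
  small \<open>\<epsilon>\<close> by continuity.\<close>

lemma small_perturbation:
  fixes s' :: "'v \<Rightarrow> real"
  assumes "finite H" "finite W" "inj_on s' (insert h W)" "h \<notin> W"
  shows "\<forall>\<^sub>F \<epsilon> in at_right 0. \<forall>x\<in>H. \<forall>w\<in>W. 0 < (s' h + \<epsilon> * sH x - s' w) * (s' h - s' w)"
proof (intro eventually_ball_finite assms(1,2) ballI)
  fix x w assume "x \<in> H" "w \<in> W"
  have "s' h - s' w \<noteq> 0" using assms(3,4) \<open>w \<in> W\<close> by (auto simp: inj_on_def)
  then have "0 < (s' h + 0 * sH x - s' w) * (s' h - s' w)"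
    by (auto simp: zero_less_mult_iff)
  moreover have "((\<lambda>\<epsilon>. (s' h + \<epsilon> * sH x - s' w) * (s' h - s' w)) \<longlongrightarrow>
      (s' h + 0 * sH x - s' w) * (s' h - s' w)) (at_right 0)"
    by (intro tendsto_intros)
  ultimately show "\<forall>\<^sub>F \<epsilon> in at_right 0. 0 < (s' h + \<epsilon> * sH x - s' w) * (s' h - s' w)"
    by (rule order_tendstoD(1)[rotated])
qed

lemma connecting_orders_blow_up:
  fixes V H :: "'v set"
  assumes fin: "finite V" and H: "H \<subseteq> V" "h \<in> H"
    and edge: "\<And>e. e \<in> E \<Longrightarrow> card e = 2 \<and> e \<subseteq> V"
  defines "\<phi> \<equiv> \<lambda>z. if z \<in> H then h else z"
  assumes oH: "connecting_orders H {e \<in> E. e \<subseteq> H} sH tH"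
    and oV: "connecting_orders (insert h (V - H)) ((\<lambda>e. \<phi> ` e) ` {e \<in> E. \<not> e \<subseteq> H}) s' t'"
  shows "\<exists>s t. connecting_orders V E s t"
proof -
  have finH: "finite H" using fin H(1) finite_subset by blast
  note H_def = oH[unfolded connecting_orders_def] and V_def = oV[unfolded connecting_orders_def]
  have "\<forall>\<^sub>F \<epsilon> in at_right (0::real). 0 < \<epsilon>" by (rule eventually_at_right_less)
  moreover have "\<forall>\<^sub>F \<epsilon> in at_right 0. \<forall>x\<in>H. \<forall>w\<in>V - H. 0 < (s' h + \<epsilon> * sH x - s' w) * (s' h - s' w)"
    by (rule small_perturbation) (use fin finH H V_def in auto)
  moreover have "\<forall>\<^sub>F \<epsilon> in at_right 0. \<forall>x\<in>H. \<forall>w\<in>V - H. 0 < (t' h + \<epsilon> * tH x - t' w) * (t' h - t' w)"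
    by (rule small_perturbation) (use fin finH H V_def in auto)
  ultimately have "\<forall>\<^sub>F \<epsilon> in at_right 0. 0 < \<epsilon> \<and>
      (\<forall>x\<in>H. \<forall>w\<in>V - H. 0 < (s' h + \<epsilon> * sH x - s' w) * (s' h - s' w)) \<and>
      (\<forall>x\<in>H. \<forall>w\<in>V - H. 0 < (t' h + \<epsilon> * tH x - t' w) * (t' h - t' w))"
    by (intro eventually_conj)
  from eventually_happens'[OF trivial_limit_at_right_real this]
  obtain \<epsilon> where \<epsilon>: "0 < \<epsilon>"
    "\<And>x w. x \<in> H \<Longrightarrow> w \<in> V - H \<Longrightarrow> 0 < (s' h + \<epsilon> * sH x - s' w) * (s' h - s' w)"
    "\<And>x w. x \<in> H \<Longrightarrow> w \<in> V - H \<Longrightarrow> 0 < (t' h + \<epsilon> * tH x - t' w) * (t' h - t' w)"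
    by blast
  \<comment> \<open>A copy of \<open>H\<close> scaled by \<open>\<epsilon>\<close> takes the place
    of \<open>h\<close>: positivity of \<open>\<epsilon>\<close> preserves the order inside
    \<open>H\<close>, its smallness the order relative to the other vertices.\<close>
  define s where "s x = (if x \<in> H then s' h + \<epsilon> * sH x else s' x)" for x
  define t where "t x = (if x \<in> H then t' h + \<epsilon> * tH x else t' x)" for x
  have s_in: "s x - s y = \<epsilon> * (sH x - sH y)" if "x \<in> H" "y \<in> H" for x y
    using that by (simp add: s_def algebra_simps)
  have t_in: "t x - t y = \<epsilon> * (tH x - tH y)" if "x \<in> H" "y \<in> H" for x y
    using that by (simp add: t_def algebra_simps)
  \<comment> \<open>Stated for a generic order \<open>g\<close> so that it serves both
    \<open>s\<close> and \<open>t\<close>.\<close>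
  have out: "0 < (g x - g y) * (g' (\<phi> x) - g' (\<phi> y))"
    if V: "x \<in> V" "y \<in> V" "x \<noteq> y" "\<not> (x \<in> H \<and> y \<in> H)"
      and g: "\<And>x. g x = (if x \<in> H then g' h + \<epsilon> * gH x else g' x)"
      and inj: "inj_on g' (insert h (V - H))"
      and pos: "\<And>x w. x \<in> H \<Longrightarrow> w \<in> V - H \<Longrightarrow> 0 < (g' h + \<epsilon> * gH x - g' w) * (g' h - g' w)"
    for x y and g g' gH :: "'v \<Rightarrow> real"
  proof -
    consider "x \<in> H" "y \<notin> H" | "x \<notin> H" "y \<in> H" | "x \<notin> H" "y \<notin> H" using V by blast
    then show ?thesis
    proof cases
      case 1
      then show ?thesis using pos[of x y] V by (simp add: g \<phi>_def)
    next
      case 2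
      then have "(g x - g y) * (g' (\<phi> x) - g' (\<phi> y)) = (g' h + \<epsilon> * gH y - g' x) * (g' h - g' x)"
        by (simp add: g \<phi>_def algebra_simps)
      then show ?thesis using pos[of y x] V 2 by simp
    next
      case 3
      then have "g' x - g' y \<noteq> 0" using inj V by (auto simp: inj_on_def)
      then show ?thesis using 3 by (auto simp: g \<phi>_def zero_less_mult_iff)
    qed
  qed
  have s_out: "0 < (s x - s y) * (s' (\<phi> x) - s' (\<phi> y))"
    if "x \<in> V" "y \<in> V" "x \<noteq> y" "\<not> (x \<in> H \<and> y \<in> H)" for x y
    by (rule out[OF that s_def _ \<epsilon>(2)]) (use V_def in auto)
  have t_out: "0 < (t x - t y) * (t' (\<phi> x) - t' (\<phi> y))"
    if "x \<in> V" "y \<in> V" "x \<noteq> y" "\<not> (x \<in> H \<and> y \<in> H)" for x y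
    by (rule out[OF that t_def _ \<epsilon>(3)]) (use V_def in auto)
  have "connects V (concordant E s t)"
  proof (rule connects_blow_up[OF H edge meta_eq_to_obj_eq[OF \<phi>_def]])
    show "connects H (concordant {e \<in> E. e \<subseteq> H} sH tH)" using H_def by blast
    show "connects (insert h (V - H)) (concordant ((\<lambda>e. \<phi> ` e) ` {e \<in> E. \<not> e \<subseteq> H}) s' t')"
      using V_def by blast
    show "0 < (s x - s y) * (t x - t y)"
      if "x \<in> H" "y \<in> H" "0 < (sH x - sH y) * (tH x - tH y)" for x y
      using that \<epsilon>(1) unfolding s_in[OF that(1,2)] t_in[OF that(1,2)]
      by (auto simp: zero_less_mult_iff mult_less_0_iff)
  qed (use s_out t_out in auto)
  moreover have "connects V (concordant E s (\<lambda>x. - t x))"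
  proof (rule connects_blow_up[OF H edge meta_eq_to_obj_eq[OF \<phi>_def]])
    show "connects H (concordant {e \<in> E. e \<subseteq> H} sH (\<lambda>x. - tH x))" using H_def by blast
    show "connects (insert h (V - H))
        (concordant ((\<lambda>e. \<phi> ` e) ` {e \<in> E. \<not> e \<subseteq> H}) s' (\<lambda>x. - t' x))"
      using V_def by blast
    show "0 < (s x - s y) * (- t x - - t y)"
      if xy: "x \<in> H" "y \<in> H" "0 < (sH x - sH y) * (- tH x - - tH y)" for x y
    proof -
      have "- t x - - t y = \<epsilon> * (- tH x - - tH y)"
        using t_in[OF xy(1,2)] by (simp add: algebra_simps)
      then show ?thesis
        using xy(3) \<epsilon>(1) unfolding s_in[OF xy(1,2)]
        by (auto simp: zero_less_mult_iff mult_less_0_iff)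
    qed
    show "0 < (s x - s y) * (s' (\<phi> x) - s' (\<phi> y)) \<and>
        0 < (- t x - - t y) * (- t' (\<phi> x) - - t' (\<phi> y))"
      if xy: "x \<in> V" "y \<in> V" "x \<noteq> y" "\<not> (x \<in> H \<and> y \<in> H)" for x y
      using s_out[OF xy] t_out[OF xy] by (simp add: algebra_simps)
  qed
  moreover have "inj_on s V"
  proof (rule inj_onI, rule ccontr)
    fix x y assume xy: "x \<in> V" "y \<in> V" "s x = s y" "x \<noteq> y"
    show False
    proof (cases "x \<in> H \<and> y \<in> H")
      case True
      then show False using s_in[of x y] xy H_def \<epsilon>(1) by (auto simp: inj_on_def)
    qed (use s_out[OF xy(1,2,4)] xy(3) in simp)
  qed
  moreover have "inj_on t V"
  proof (rule inj_onI, rule ccontr)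
    fix x y assume xy: "x \<in> V" "y \<in> V" "t x = t y" "x \<noteq> y"
    show False
    proof (cases "x \<in> H \<and> y \<in> H")
      case True
      then show False using t_in[of x y] xy H_def \<epsilon>(1) by (auto simp: inj_on_def)
    qed (use t_out[OF xy(1,2,4)] xy(3) in simp)
  qed
  ultimately show ?thesis unfolding connecting_orders_def by blast
qed

text \<open>One vertex and three edges go, one edge comes, so the total is right. The new edge could
  only violate sparsity on a tight set containing \<open>a\<close> and \<open>b\<close> but not
  \<open>v\<close>; this would be a proper tight subset with at least two vertices.\<close>

lemma tight_reduce_three:
  assumes t: "tight V E" and v: "v \<in> V"
    and N: "{x. {v, x} \<in> E} = {a, b, c}" "a \<noteq> b" "a \<noteq> c" "b \<noteq> c" "{a, b} \<notin> E"
    and no_tight: "\<And>H. H \<subset> V \<Longrightarrow> 2 \<le> card H \<Longrightarrow> card {e \<in> E. e \<subseteq> H} + 2 \<noteq> 2 * card H"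
  shows "tight (V - {v}) (insert {a, b} {e \<in> E. e \<subseteq> V - {v}})"
  unfolding tight_def
proof (intro conjI allI impI ballI)
  have fin: "finite V" "finite E" using tightD(1)[OF t] tight_finite_edges[OF t] .
  have ab: "a \<in> V - {v}" "b \<in> V - {v}"
    using tight_neighbour[OF t, of v a] tight_neighbour[OF t, of v b] N(1) by auto
  have cV: "card (V - {v}) + 1 = card V"
    using fin(1) v by (metis Suc_eq_plus1 card_Suc_Diff1)
  show "finite (V - {v})" "V - {v} \<noteq> {}" using fin ab by auto
  have "card {e \<in> E. v \<in> e} = 3"
    unfolding tight_degree[OF t v] N(1) using N by simp
  then have "card {e \<in> E. e \<subseteq> V - {v}} + 3 = card E"
    using tight_degree_sum[OF t v] by simp
  moreover have "card (insert {a, b} {e \<in> E. e \<subseteq> V - {v}}) = card {e \<in> E. e \<subseteq> V - {v}} + 1"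
    using fin N(5) by simp
  ultimately show "card (insert {a, b} {e \<in> E. e \<subseteq> V - {v}}) + 2 = 2 * card (V - {v})"
    using tightD(5)[OF t] cV by linarith
  fix e assume "e \<in> insert {a, b} {e \<in> E. e \<subseteq> V - {v}}"
  then show "card e = 2" "e \<subseteq> V - {v}" using N(2) ab tightD(3)[OF t] by auto
next
  fix X assume X: "X \<subseteq> V - {v}" "X \<noteq> {}"
  let ?F = "insert {a, b} {e \<in> E. e \<subseteq> V - {v}}"
  have fin: "finite V" "finite E" using tightD(1)[OF t] tight_finite_edges[OF t] .
  have sp: "card {e \<in> E. e \<subseteq> X} + 2 \<le> 2 * card X"
    by (rule tightD(6)[OF t]) (use X in auto)
  show "card {e \<in> ?F. e \<subseteq> X} + 2 \<le> 2 * card X"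
  proof (cases "a \<in> X \<and> b \<in> X")
    case True
    have "card {a, b} \<le> card X"
      by (rule card_mono) (use True X fin finite_subset in auto)
    then have "card {e \<in> E. e \<subseteq> X} + 2 \<noteq> 2 * card X"
      using N(2) X v by (intro no_tight) auto
    moreover have "card {e \<in> ?F. e \<subseteq> X} \<le> card (insert {a, b} {e \<in> E. e \<subseteq> X})"
      by (rule card_mono) (use fin in auto)
    moreover have "card (insert {a, b} {e \<in> E. e \<subseteq> X}) \<le> card {e \<in> E. e \<subseteq> X} + 1"
      using fin by (simp add: card_insert_if)
    ultimately show ?thesis using sp by linarith
  next
    case False
    then have "card {e \<in> ?F. e \<subseteq> X} \<le> card {e \<in> E. e \<subseteq> X}"
      by (intro card_mono) (use fin in auto)
    then show ?thesis using sp by linarith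
  qed
qed

text \<open>With two neighbours in \<open>H\<close>, adding \<open>w\<close> brings one vertex and
  two edges, so the enlarged set is tight too. By maximality it is all of \<open>V\<close>, but then
  \<open>w\<close> has degree 2.\<close>

lemma tight_maximal_subset_neighbours:
  assumes t: "tight V E" and H: "H \<subset> V" "card {e \<in> E. e \<subseteq> H} + 2 = 2 * card H"
    and maximal: "\<And>K. K \<subset> V \<Longrightarrow> 2 \<le> card K \<Longrightarrow> card {e \<in> E. e \<subseteq> K} + 2 = 2 * card K \<Longrightarrow>
      card K \<le> card H"
    and deg: "\<And>v. v \<in> V \<Longrightarrow> card {e \<in> E. v \<in> e} \<noteq> 2"
    and w: "w \<in> V - H" "x \<in> H" "x' \<in> H" "{w, x} \<in> E" "{w, x'} \<in> E"
  shows "x = x'"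
proof (rule ccontr)
  assume ne: "x \<noteq> x'"
  have fin: "finite V" "finite E" "finite H"
    using tightD(1)[OF t] tight_finite_edges[OF t] H(1) finite_subset by auto
  let ?K = "insert w H"
  have cK: "card ?K = card H + 1" using fin(3) w(1) by simp
  have K: "?K \<subseteq> V" using H(1) w(1) by auto
  have "card ({e \<in> E. e \<subseteq> H} \<union> {{w, x}, {w, x'}}) \<le> card {e \<in> E. e \<subseteq> ?K}"
    by (rule card_mono) (use fin w in auto)
  moreover have "card ({e \<in> E. e \<subseteq> H} \<union> {{w, x}, {w, x'}}) = card {e \<in> E. e \<subseteq> H} + 2"
  proof -
    have "{w, x} \<noteq> {w, x'}" using ne by (auto simp: doubleton_eq_iff)
    then show ?thesis using fin w(1) by (subst card_Un_disjoint) auto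
  qed
  moreover have "card {e \<in> E. e \<subseteq> ?K} + 2 \<le> 2 * card ?K"
    by (rule tightD(6)[OF t K]) auto
  ultimately have "card {e \<in> E. e \<subseteq> ?K} + 2 = 2 * card ?K" using cK H(2) by linarith
  moreover have "1 \<le> card H" using w(2) fin(3) by (metis One_nat_def Suc_leI card_gt_0_iff empty_iff)
  ultimately have "\<not> ?K \<subset> V" using maximal[of ?K] cK by linarith
  then have VK: "V = ?K" using K by blast
  then have "V - {w} = H" using w(1) by auto
  then have "card E = card {e \<in> E. e \<subseteq> H} + card {e \<in> E. w \<in> e}"
    using tight_degree_sum[OF t, of w] w(1) by simp
  moreover have "card V = card H + 1" using cK VK by simp
  ultimately have "card {e \<in> E. w \<in> e} = 2" using tightD(5)[OF t] H(2) by linarith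
  then show False using deg w(1) by blast
qed

text \<open>Six edges on four vertices reach the sparsity bound \<open>2 * 4 - 2\<close>, so these
  vertices cannot form a proper subset.\<close>

lemma tight_closed_neighbourhood_K4:
  assumes t: "tight V E"
    and ad: "distinct [v, a, b, c]"
      "{v, a} \<in> E" "{v, b} \<in> E" "{v, c} \<in> E" "{a, b} \<in> E" "{a, c} \<in> E" "{b, c} \<in> E"
    and no_tight: "\<And>H. H \<subset> V \<Longrightarrow> 2 \<le> card H \<Longrightarrow> card {e \<in> E. e \<subseteq> H} + 2 \<noteq> 2 * card H"
  shows "V = {v, a, b, c}"
proof (rule ccontr)
  let ?K = "{v, a, b, c}"
  assume "V \<noteq> ?K"
  moreover have K: "?K \<subseteq> V" using tightD(4)[OF t ad(2)] tightD(4)[OF t ad(7)] by auto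
  ultimately have "?K \<subset> V" by blast
  moreover have cK: "card ?K = 4" using ad(1) by simp
  ultimately have "card {e \<in> E. e \<subseteq> ?K} + 2 \<noteq> 2 * card ?K" by (intro no_tight) auto
  moreover have "card {e \<in> E. e \<subseteq> ?K} + 2 \<le> 2 * card ?K"
    by (rule tightD(6)[OF t K]) simp
  moreover have "card {{v, a}, {v, b}, {v, c}, {a, b}, {a, c}, {b, c}} \<le> card {e \<in> E. e \<subseteq> ?K}"
    by (rule card_mono) (use ad tight_finite_edges[OF t] in auto)
  moreover have "card {{v, a}, {v, b}, {v, c}, {a, b}, {a, c}, {b, c}} = 6"
    using ad(1) by (auto simp: card_insert_if doubleton_eq_iff)
  ultimately show False using cK by linarith
qed

theorem tight_imp_connecting_orders:
  fixes V :: "'v set"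
  assumes "tight V E"
  shows "\<exists>s t. connecting_orders V E s t"
  using assms
proof (induction "card V" arbitrary: V E rule: less_induct)
  case less
  note t = less.prems
  have fin: "finite V" "finite E" using tightD(1)[OF t] tight_finite_edges[OF t] .
  have Diff: "card (V - {v}) < card V" "insert v (V - {v}) = V" if "v \<in> V" for v
    using card_Diff1_less[OF fin(1) that] that by auto
  \<comment> \<open>Degree 2 is treated before the tight subsets, because the contraction relies on
    its absence.\<close>
  consider (single) "card V = 1"
    | (two) v where "v \<in> V" "card {e \<in> E. v \<in> e} = 2" "card V \<noteq> 1"
    | (sub) "\<And>v. v \<in> V \<Longrightarrow> card {e \<in> E. v \<in> e} \<noteq> 2"
        "\<exists>H. H \<subset> V \<and> 2 \<le> card H \<and> card {e \<in> E. e \<subseteq> H} + 2 = 2 * card H"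
    | (three) "\<And>v. v \<in> V \<Longrightarrow> card {e \<in> E. v \<in> e} \<noteq> 2"
        "\<And>H. H \<subset> V \<Longrightarrow> 2 \<le> card H \<Longrightarrow> card {e \<in> E. e \<subseteq> H} + 2 \<noteq> 2 * card H"
        "card V \<noteq> 1"
    by blast
  then show ?case
  proof cases
    case single
    then obtain v where "V = {v}" by (auto simp: card_1_singleton_iff)
    then have "connecting_orders V E (\<lambda>_. 0) (\<lambda>_. 0)"
      by (simp add: connecting_orders_def connects_def)
    then show ?thesis by blast
  next
    case two
    let ?F = "{e \<in> E. e \<subseteq> V - {v}}"
    have "card (V - {v}) + 1 = card V"
      using fin(1) two(1) by (metis Suc_eq_plus1 card_Suc_Diff1)
    then have "V - {v} \<noteq> {}" "card ?F + 2 = 2 * card (V - {v})"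
      using two(2,3) tight_degree_sum[OF t two(1)] tightD(5)[OF t] by (force, linarith)
    then have "tight (V - {v}) ?F" by (intro tight_induced[OF t]) auto
    then obtain s u where o: "connecting_orders (V - {v}) ?F s u"
      using less.hyps Diff(1)[OF two(1)] by blast
    obtain a b where ab: "{x. {v, x} \<in> E} = {a, b}" "a \<noteq> b"
      using two(2) unfolding tight_degree[OF t two(1)] by (meson card_2_iff)
    have "\<exists>s u. connecting_orders (insert v (V - {v})) E s u"
      by (rule connecting_orders_extend_two[OF o, where a = a and b = b])
        (use fin ab tight_neighbour[OF t, of v] in auto)
    then show ?thesis using Diff(2)[OF two(1)] by simp
  next
    case sub
    \<comment> \<open>Singletons satisfy the edge count trivially, but contracting one changes
      nothing; \<open>2 \<le> card H\<close> makes the quotient smaller.\<close>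
    let ?P = "\<lambda>H. H \<subset> V \<and> 2 \<le> card H \<and> card {e \<in> E. e \<subseteq> H} + 2 = 2 * card H"
    obtain H0 where "?P H0" using sub(2) by blast
    moreover have "\<forall>H. ?P H \<longrightarrow> card H < card V" using psubset_card_mono[OF fin(1)] by blast
    ultimately have "\<exists>H. ?P H \<and> (\<forall>K. ?P K \<longrightarrow> card K \<le> card H)"
      by (rule ex_has_greatest_nat)
    then obtain H where H: "H \<subset> V" "2 \<le> card H" "card {e \<in> E. e \<subseteq> H} + 2 = 2 * card H"
      and maximal: "\<And>K. K \<subset> V \<Longrightarrow> 2 \<le> card K \<Longrightarrow> card {e \<in> E. e \<subseteq> K} + 2 = 2 * card K \<Longrightarrow>
        card K \<le> card H" by blast
    have HV: "H \<subseteq> V" and finH: "finite H" using H(1) fin(1) finite_subset by auto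
    have "H \<noteq> {}" using H(2) by auto
    then obtain h where h: "h \<in> H" by blast
    have "tight H {e \<in> E. e \<subseteq> H}" by (rule tight_induced[OF t HV \<open>H \<noteq> {}\<close> H(3)])
    then obtain sH tH where oH: "connecting_orders H {e \<in> E. e \<subseteq> H} sH tH"
      using less.hyps psubset_card_mono[OF fin(1) H(1)] by blast
    have "tight (insert h (V - H)) ((\<lambda>e. (\<lambda>z. if z \<in> H then h else z) ` e) ` {e \<in> E. \<not> e \<subseteq> H})"
      by (rule tight_contract[OF t HV h H(3)])
        (rule tight_maximal_subset_neighbours[OF t H(1,3) maximal sub(1)])
    moreover have "card (insert h (V - H)) < card V"
    proof -
      have "card (V - H) = card V - card H" "card H \<le> card V"
        using card_Diff_subset[OF finH HV] card_mono[OF fin(1) HV] by auto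
      then show ?thesis using fin(1) h H(2) by simp
    qed
    ultimately obtain s' t' where oV: "connecting_orders (insert h (V - H))
        ((\<lambda>e. (\<lambda>z. if z \<in> H then h else z) ` e) ` {e \<in> E. \<not> e \<subseteq> H}) s' t'"
      using less.hyps by blast
    show ?thesis
      by (rule connecting_orders_blow_up[OF fin(1) HV h _ oH oV])
        (use tightD(3,4)[OF t] in blast)
  next
    case three
    obtain v where v: "v \<in> V" "card {e \<in> E. v \<in> e} \<le> 3" using tight_small_degree[OF t] by blast
    have "card {e \<in> E. v \<in> e} = 3"
      using v(2) three(1)[OF v(1)] tight_min_degree[OF t v(1) three(3)] by linarith
    then obtain a b c where N: "{x. {v, x} \<in> E} = {a, b, c}" and d: "a \<noteq> b" "a \<noteq> c" "b \<noteq> c"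
      unfolding tight_degree[OF t v(1)] by (metis card_3_iff)
    \<comment> \<open>Stated for any naming of the three neighbours, so that whichever pair is
      non-adjacent can play the role of \<open>a\<close> and \<open>b\<close>.\<close>
    have reduce: ?thesis
      if N: "{x. {v, x} \<in> E} = {a, b, c}" "a \<noteq> b" "a \<noteq> c" "b \<noteq> c" "{a, b} \<notin> E" for a b c
    proof -
      have "tight (V - {v}) (insert {a, b} {e \<in> E. e \<subseteq> V - {v}})"
        by (rule tight_reduce_three[OF t v(1) N three(2)])
      then obtain s u where o:
        "connecting_orders (V - {v}) (insert {a, b} {e \<in> E. e \<subseteq> V - {v}}) s u"
        using less.hyps Diff(1)[OF v(1)] by blast
      have "\<exists>s u. connecting_orders (insert v (V - {v})) E s u"
        by (rule connecting_orders_extend_three[OF o, where c = c])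
          (use fin N tight_neighbour[OF t, of v] in auto)
      then show ?thesis using Diff(2)[OF v(1)] by simp
    qed
    show ?thesis
    proof (cases "{a, b} \<in> E \<and> {a, c} \<in> E \<and> {b, c} \<in> E")
      case True
      have va: "{v, a} \<in> E" "{v, b} \<in> E" "{v, c} \<in> E" using N by auto
      then have dist: "distinct [v, a, b, c]" using d tight_neighbour(2)[OF t] by force
      have "V = {v, a, b, c}"
        by (rule tight_closed_neighbourhood_K4[OF t dist va _ _ _ three(2)]) (use True in auto)
      then show ?thesis using connecting_orders_K4[OF dist va] True by blast
    next
      case False
      then consider "{a, b} \<notin> E" | "{a, c} \<notin> E" | "{b, c} \<notin> E" by blast
      then show ?thesis
      proof cases
        case 1
        show ?thesis by (rule reduce[OF N d 1])
      next
        case 2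
        show ?thesis by (rule reduce[of a c b]) (use N d 2 in auto)
      next
        case 3
        show ?thesis by (rule reduce[of b c a]) (use N d 3 in auto)
      qed
    qed
  qed
qed

section \<open>Rigidity in the quadrilateral norm\<close>

text \<open>The colour condition as a strict inequality, equivalent to unique attainment by
  \<open>dominant_iff\<close>. In this form it visibly survives small movements of
  \<open>a\<close>.\<close>

definition dominant :: "(2 \<Rightarrow> real^2) \<Rightarrow> real^2 \<Rightarrow> 2 \<Rightarrow> bool" where
  "dominant b a k \<longleftrightarrow> (\<forall>l. l \<noteq> k \<longrightarrow> \<bar>a \<bullet> b l\<bar> < \<bar>a \<bullet> b k\<bar>)"

lemma dominant_iff: "dominant b a k \<longleftrightarrow> (\<exists>!l. attains b a l) \<and> (THE l. attains b a l) = k"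
proof
  assume d: "dominant b a k"
  have att: "attains b a l \<longleftrightarrow> l = k" for l
    using d exhaust_2[of k] exhaust_2[of l]
    unfolding dominant_def attains_def quad_norm_def by auto
  show "(\<exists>!l. attains b a l) \<and> (THE l. attains b a l) = k"
    unfolding att by simp
next
  assume u: "(\<exists>!l. attains b a l) \<and> (THE l. attains b a l) = k"
  then have k: "attains b a k" using theI'[of "attains b a"] by metis
  then have "\<not> attains b a l" if "l \<noteq> k" for l using u that by metis
  moreover have "\<bar>a \<bullet> b l\<bar> \<le> quad_norm b a" for l
    using exhaust_2[of l] by (auto simp: quad_norm_def)
  ultimately show "dominant b a k"
    using k unfolding dominant_def attains_def by (metis order_le_less)
qed

lemma ex1_attains_imp_dominant: "\<exists>!l. attains b a l \<Longrightarrow> \<exists>k. dominant b a k"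
  by (simp add: dominant_iff)

lemma dominant_unique: "dominant b a k \<Longrightarrow> dominant b a l \<Longrightarrow> k = l"
  by (simp add: dominant_iff)

lemma dominant_minus: "dominant b (x - y) k \<longleftrightarrow> dominant b (y - x) k"
proof -
  have "\<bar>(x - y) \<bullet> b l\<bar> = \<bar>(y - x) \<bullet> b l\<bar>" for l
    by (simp add: inner_diff_left abs_minus_commute)
  then show ?thesis by (simp add: dominant_def)
qed

lemma kappa_dominant: "dominant b a k \<Longrightarrow> kappa b a = b k"
  by (simp add: dominant_iff kappa_def)

lemma kappa_minus: "kappa b (- a) = kappa b a"
proof -
  have "attains b (- a) = attains b a" by (rule ext) (rule attains_minus)
  then show ?thesis by (simp add: kappa_def)
qed

text \<open>Near a point where only one functional attains the maximum, the norm coincides with that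
  functional up to a fixed sign.\<close>

lemma eventually_quad_norm_eq:
  assumes f: "(f \<longlongrightarrow> a) F" and d: "dominant b a k"
  shows "\<forall>\<^sub>F t in F. quad_norm b (f t) = sgn (a \<bullet> b k) * (f t \<bullet> b k)"
proof -
  have "\<exists>l. l \<noteq> k" by (metis zero_neq_one)
  then obtain l where l: "l \<noteq> k" by blast
  have lt: "\<bar>a \<bullet> b l\<bar> < \<bar>a \<bullet> b k\<bar>" using d l by (auto simp: dominant_def)
  \<comment> \<open>Positivity of this difference expresses both that index \<open>k\<close> still
    dominates and that the sign of the inner product has not changed.\<close>
  have "((\<lambda>t. sgn (a \<bullet> b k) * (f t \<bullet> b k) - \<bar>f t \<bullet> b l\<bar>) \<longlongrightarrow>
      sgn (a \<bullet> b k) * (a \<bullet> b k) - \<bar>a \<bullet> b l\<bar>) F"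
    by (intro tendsto_intros f)
  moreover have "0 < sgn (a \<bullet> b k) * (a \<bullet> b k) - \<bar>a \<bullet> b l\<bar>"
    using lt by (simp add: abs_sgn mult.commute)
  ultimately have "\<forall>\<^sub>F t in F. 0 < sgn (a \<bullet> b k) * (f t \<bullet> b k) - \<bar>f t \<bullet> b l\<bar>"
    by (rule order_tendstoD(1))
  then show ?thesis
  proof eventually_elim
    case (elim t)
    then have pos: "\<bar>f t \<bullet> b l\<bar> < sgn (a \<bullet> b k) * (f t \<bullet> b k)" by simp
    have "\<bar>sgn (a \<bullet> b k) * (f t \<bullet> b k)\<bar> = \<bar>f t \<bullet> b k\<bar>"
      using lt by (auto simp: abs_mult sgn_if)
    then have "\<bar>f t \<bullet> b k\<bar> = sgn (a \<bullet> b k) * (f t \<bullet> b k)" using pos by linarith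
    then show ?case
      using pos l exhaust_2[of k] exhaust_2[of l] unfolding quad_norm_def by auto
  qed
qed

text \<open>By local linearity the difference quotient is eventually the constant \<open>?c\<close>.
  Its sign factor is nonzero because a dominating inner product cannot vanish.\<close>

lemma quad_norm_little_o_iff:
  assumes d: "dominant b a k"
  shows "(\<lambda>t. quad_norm b (a + t *\<^sub>R w) - quad_norm b a) \<in> o[at 0](\<lambda>t::real. t)
    \<longleftrightarrow> w \<bullet> b k = 0"
proof -
  let ?c = "sgn (a \<bullet> b k) * (w \<bullet> b k)"
  have "((\<lambda>t. a + t *\<^sub>R w) \<longlongrightarrow> a + 0 *\<^sub>R w) (at 0)" by (intro tendsto_intros)
  then have lim: "((\<lambda>t. a + t *\<^sub>R w) \<longlongrightarrow> a) (at 0)" by simp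
  have qa: "quad_norm b a = sgn (a \<bullet> b k) * (a \<bullet> b k)"
    using eventually_quad_norm_eq[OF tendsto_const[of a "at (0::real)"] d]
    by (simp add: eventually_const)
  have ev: "\<forall>\<^sub>F t in at 0. (quad_norm b (a + t *\<^sub>R w) - quad_norm b a) / t = ?c"
    using eventually_quad_norm_eq[OF lim d] eventually_neq_at_within[of 0 0 UNIV]
    by eventually_elim (simp add: qa inner_add_left algebra_simps)
  have "a \<bullet> b k \<noteq> 0"
  proof -
    obtain l where "l \<noteq> k" by (metis zero_neq_one)
    then have "\<bar>a \<bullet> b l\<bar> < \<bar>a \<bullet> b k\<bar>" using d by (auto simp: dominant_def)
    then show ?thesis by auto
  qed
  then have c0: "?c = 0 \<longleftrightarrow> w \<bullet> b k = 0" by (simp add: sgn_zero_iff)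
  show ?thesis
  proof
    assume "(\<lambda>t. quad_norm b (a + t *\<^sub>R w) - quad_norm b a) \<in> o[at 0](\<lambda>t::real. t)"
    then have "((\<lambda>t. (quad_norm b (a + t *\<^sub>R w) - quad_norm b a) / t) \<longlongrightarrow> 0) (at 0)"
      by (rule smalloD_tendsto)
    moreover have "((\<lambda>t. (quad_norm b (a + t *\<^sub>R w) - quad_norm b a) / t) \<longlongrightarrow> ?c) (at 0)"
      by (rule tendsto_eventually[OF ev])
    ultimately have "?c = 0" by (rule tendsto_unique[OF trivial_limit_at, symmetric])
    then show "w \<bullet> b k = 0" using c0 by simp
  next
    assume "w \<bullet> b k = 0"
    then have c: "?c = 0" using c0 by simp
    have "((\<lambda>t. (quad_norm b (a + t *\<^sub>R w) - quad_norm b a) / t) \<longlongrightarrow> 0) (at 0)"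
      using tendsto_eventually[OF ev] unfolding c .
    then show "(\<lambda>t. quad_norm b (a + t *\<^sub>R w) - quad_norm b a) \<in> o[at 0](\<lambda>t::real. t)"
      by (rule smalloI_tendsto) (rule eventually_neq_at_within)
  qed
qed

text \<open>The component of \<open>b k\<close> orthogonal to the other vector, suitably scaled, is
  the dual basis vector.\<close>

lemma dual_vector_exists:
  fixes b :: "2 \<Rightarrow> real^2"
  assumes "b 1 \<noteq> b 2" "independent {b 1, b 2}"
  shows "\<exists>w. \<forall>l. w \<bullet> b l = (if l = k then 1 else 0)"
proof -
  obtain l where lk: "l \<noteq> k" by (metis zero_neq_one)
  then have set: "{b 1, b 2} = {b k, b l}" and ne: "b k \<noteq> b l"
    using exhaust_2[of k] exhaust_2[of l] assms(1) by auto
  obtain y z where yz: "y \<in> span {b l}" "\<And>w. w \<in> span {b l} \<Longrightarrow> orthogonal z w" "b k = y + z"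
    using orthogonal_subspace_decomp_exists[of "{b l}" "b k"] by blast
  have "b k \<notin> span {b l}"
    using assms(2) ne unfolding set by (metis independent_insert singletonD)
  then have "z \<noteq> 0" using yz by auto
  have zl: "z \<bullet> b l = 0" using yz(2)[of "b l"] by (simp add: orthogonal_def span_base)
  have "z \<bullet> b k = z \<bullet> z" using yz(2)[OF yz(1)] by (simp add: yz(3) orthogonal_def inner_add_right)
  then have "(z /\<^sub>R (z \<bullet> z)) \<bullet> b k = 1" "(z /\<^sub>R (z \<bullet> z)) \<bullet> b l = 0"
    using \<open>z \<noteq> 0\<close> zl by auto
  then have "\<forall>m. (z /\<^sub>R (z \<bullet> z)) \<bullet> b m = (if m = k then 1 else 0)"
    using lk exhaust_2[of k] exhaust_2[of l] unfolding forall_2 by auto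
  then show ?thesis by blast
qed

lemma inner_basis_zero:
  fixes b :: "2 \<Rightarrow> real^2"
  assumes "b 1 \<noteq> b 2" "independent {b 1, b 2}" "\<And>l. x \<bullet> b l = 0"
  shows "x = 0"
proof -
  have "dim {b 1, b 2} = 2" using assms(1,2) by (simp add: dim_eq_card_independent)
  then have "span {b 1, b 2} = (UNIV :: (real^2) set)"
    by (simp flip: dim_eq_full)
  moreover have "orthogonal x y" if "y \<in> span {b 1, b 2}" for y
    by (rule orthogonal_to_span[OF that]) (use assms(3) in \<open>auto simp: orthogonal_def\<close>)
  ultimately show ?thesis by (metis UNIV_I orthogonal_self)
qed

lemma inner_basis_eq:
  fixes b :: "2 \<Rightarrow> real^2"
  assumes "b 1 \<noteq> b 2" "independent {b 1, b 2}" "\<And>l. x \<bullet> b l = y \<bullet> b l"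
  shows "x = y"
  using inner_basis_zero[OF assms(1,2), of "x - y"] assms(3) by (simp add: inner_diff_left)

text \<open>Two arbitrary points are compared through a far-away third point.\<close>

lemma trivial_flex_iff_constant:
  fixes p :: "'v \<Rightarrow> real^2"
  assumes b: "b 1 \<noteq> b 2" "independent {b 1, b 2}"
  shows "trivial_flex (quad_norm b) p u \<longleftrightarrow> (\<exists>c. \<forall>v. u v = c)"
proof
  assume "\<exists>c. \<forall>v. u v = c"
  then obtain c where c: "\<And>v. u v = c" by blast
  let ?\<gamma> = "\<lambda>x t. x + t *\<^sub>R c"
  have der: "(?\<gamma> x has_vector_derivative c) (at 0)" for x
    by (auto intro!: derivative_eq_intros)
  then have "?\<gamma> x differentiable (at 0)" for x by (rule differentiableI_vector)
  then have "rigid_motion (quad_norm b) ?\<gamma>"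
    unfolding rigid_motion_def by (auto intro!: continuous_intros)
  moreover have "u v = vector_derivative (?\<gamma> (p v)) (at 0)" for v
    using vector_derivative_at[OF der] c by simp
  ultimately show "trivial_flex (quad_norm b) p u" unfolding trivial_flex_def by blast
next
  assume "trivial_flex (quad_norm b) p u"
  then obtain \<gamma> where \<gamma>: "rigid_motion (quad_norm b) \<gamma>"
    and u: "\<And>v. u v = vector_derivative (\<gamma> (p v)) (at 0)"
    unfolding trivial_flex_def by blast
  define d where "d x = vector_derivative (\<gamma> x) (at 0)" for x
  have der: "(\<gamma> x has_vector_derivative d x) (at 0)" and \<gamma>0: "\<gamma> x 0 = x" for x
    using \<gamma> vector_derivative_works unfolding rigid_motion_def d_def by blast+
  have iso: "quad_norm b (\<gamma> x t - \<gamma> y t) = quad_norm b (x - y)" if "\<bar>t\<bar> \<le> 1" for t x y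
    using \<gamma> that unfolding rigid_motion_def by (auto simp: abs_le_iff)
  \<comment> \<open>Near time 0 the preserved norm is a signed inner product with
    \<open>b k\<close>, which is thus constant and has derivative zero.\<close>
  have key: "d x \<bullet> b k = d y \<bullet> b k" if dom: "dominant b (x - y) k" for x y k
  proof -
    let ?\<sigma> = "sgn ((x - y) \<bullet> b k)"
    have dd: "((\<lambda>t. \<gamma> x t - \<gamma> y t) has_vector_derivative d x - d y) (at 0)"
      by (intro has_vector_derivative_diff der)
    then have lim: "((\<lambda>t. \<gamma> x t - \<gamma> y t) \<longlongrightarrow> x - y) (at 0)"
      using has_vector_derivative_continuous[OF dd] by (simp add: \<gamma>0 isCont_def)
    have "\<forall>\<^sub>F t in at (0::real). t \<in> {-1<..<1}"
      by (rule eventually_at_in_open') auto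
    then have ev: "\<forall>\<^sub>F t in at 0. ?\<sigma> * ((\<gamma> x t - \<gamma> y t) \<bullet> b k) = quad_norm b (x - y)"
      using eventually_quad_norm_eq[OF lim dom] by eventually_elim (use iso in auto)
    have "((\<lambda>t. ?\<sigma> * ((\<gamma> x t - \<gamma> y t) \<bullet> b k)) \<longlongrightarrow> ?\<sigma> * ((x - y) \<bullet> b k)) (at 0)"
      by (intro tendsto_intros lim)
    \<comment> \<open>The filter \<open>at 0\<close> leaves out the point 0 itself; the value there
      is recovered as a limit.\<close>
    then have at0: "?\<sigma> * ((\<gamma> x 0 - \<gamma> y 0) \<bullet> b k) = quad_norm b (x - y)"
      using tendsto_unique[OF trivial_limit_at _ tendsto_eventually[OF ev]] \<gamma>0 by simp
    have "((\<lambda>t. (\<gamma> x t - \<gamma> y t) \<bullet> b k) has_vector_derivative (d x - d y) \<bullet> b k) (at 0)"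
      by (rule bounded_linear.has_vector_derivative[OF bounded_linear_inner_left dd])
    then have "((\<lambda>t. (\<gamma> x t - \<gamma> y t) \<bullet> b k) has_field_derivative (d x - d y) \<bullet> b k) (at 0)"
      by (simp add: has_real_derivative_iff_has_vector_derivative)
    then have "((\<lambda>t. ?\<sigma> * ((\<gamma> x t - \<gamma> y t) \<bullet> b k)) has_field_derivative
        ?\<sigma> * ((d x - d y) \<bullet> b k)) (at 0)"
      by (rule DERIV_cmult)
    then have "((\<lambda>t. quad_norm b (x - y)) has_field_derivative ?\<sigma> * ((d x - d y) \<bullet> b k)) (at 0)"
      using has_field_derivative_cong_eventually[OF ev at0] by blast
    then have "?\<sigma> * ((d x - d y) \<bullet> b k) = 0"
      using DERIV_unique[OF _ DERIV_const] by blast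
    moreover have "(x - y) \<bullet> b k \<noteq> 0"
    proof -
      obtain l where "l \<noteq> k" by (metis zero_neq_one)
      then have "\<bar>(x - y) \<bullet> b l\<bar> < \<bar>(x - y) \<bullet> b k\<bar>" using dom by (auto simp: dominant_def)
      then show ?thesis by auto
    qed
    ultimately show ?thesis by (simp add: sgn_zero_iff inner_diff_left)
  qed
  have "d x = d y" for x y
  proof (rule inner_basis_eq[OF b])
    fix k
    obtain w where w: "\<And>l. w \<bullet> b l = (if l = k then 1 else 0)"
      using dual_vector_exists[OF b] by metis
    \<comment> \<open>\<open>M\<close> exceeds all coordinates of \<open>x\<close> and
      \<open>y\<close>. Since \<open>?z\<close> has coordinate \<open>2 * M\<close> in direction
      \<open>k\<close> and 0 in the other, both \<open>x - ?z\<close> and \<open>y - ?z\<close> are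
      dominated by \<open>k\<close>.\<close>
    define M where "M = 1 + \<bar>x \<bullet> b 1\<bar> + \<bar>x \<bullet> b 2\<bar> + \<bar>y \<bullet> b 1\<bar> + \<bar>y \<bullet> b 2\<bar>"
    let ?z = "(2 * M) *\<^sub>R w"
    have far: "dominant b (q - ?z) k" if q: "\<And>l. \<bar>q \<bullet> b l\<bar> < M" for q
      unfolding dominant_def
    proof (intro allI impI)
      fix l assume "l \<noteq> k"
      then show "\<bar>(q - ?z) \<bullet> b l\<bar> < \<bar>(q - ?z) \<bullet> b k\<bar>"
        using q[of l] q[of k] by (simp add: inner_diff_left w)
    qed
    have "\<bar>x \<bullet> b l\<bar> < M" "\<bar>y \<bullet> b l\<bar> < M" for l
      using exhaust_2[of l] unfolding M_def by auto
    then show "d x \<bullet> b k = d y \<bullet> b k"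
      using key[OF far, of x] key[OF far, of y] by simp
  qed
  then show "\<exists>c. \<forall>v. u v = c" using u unfolding d_def by metis
qed

section \<open>Monochrome subgraphs and flexes\<close>

lemma monochrome_iff:
  assumes wp: "well_positioned b E p"
  shows "{i, j} \<in> monochrome_subgraph b E p k \<longleftrightarrow> {i, j} \<in> E \<and> dominant b (p i - p j) k"
proof
  assume "{i, j} \<in> monochrome_subgraph b E p k"
  then obtain i' j' where ij: "{i, j} = {i', j'}" "{i', j'} \<in> E"
    "(THE l. attains b (p i' - p j') l) = k"
    unfolding monochrome_subgraph_def by blast
  then have "dominant b (p i' - p j') k"
    using wp unfolding dominant_iff well_positioned_def by blast
  then show "{i, j} \<in> E \<and> dominant b (p i - p j) k"
    using ij(1,2) dominant_minus[of b "p i'" "p j'" k] by (metis doubleton_eq_iff)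
next
  assume "{i, j} \<in> E \<and> dominant b (p i - p j) k"
  then show "{i, j} \<in> monochrome_subgraph b E p k"
    unfolding monochrome_subgraph_def dominant_iff by blast
qed

lemma monochrome_pair: "e \<in> monochrome_subgraph b E p k \<Longrightarrow> \<exists>i j. e = {i, j}"
  by (auto simp: monochrome_subgraph_def)

lemma monochrome_subset: "monochrome_subgraph b E p k \<subseteq> E"
  by (auto simp: monochrome_subgraph_def)

text \<open>Colours depend on the placement alone, so deleting an edge does not recolour the
  others.\<close>

lemma monochrome_Diff:
  "monochrome_subgraph b (E - {e}) p k = monochrome_subgraph b E p k - {e}"
  by (auto simp: monochrome_subgraph_def)

lemma well_positioned_subset: "well_positioned b E p \<Longrightarrow> F \<subseteq> E \<Longrightarrow> well_positioned b F p"
  unfolding well_positioned_def by blast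

lemma monochrome_disjoint:
  assumes "well_positioned b E p"
  shows "monochrome_subgraph b E p 1 \<inter> monochrome_subgraph b E p 2 = {}"
proof (rule ccontr)
  assume "\<not> ?thesis"
  then obtain e where e: "e \<in> monochrome_subgraph b E p 1" "e \<in> monochrome_subgraph b E p 2"
    by blast
  obtain i j where "e = {i, j}" using monochrome_pair[OF e(1)] by blast
  then have "(1 :: 2) = 2"
    using e monochrome_iff[OF assms] dominant_unique by blast
  then show False by simp
qed

lemma monochrome_cover:
  assumes wp: "well_positioned b E p" and "simple_graph E"
  shows "E = monochrome_subgraph b E p 1 \<union> monochrome_subgraph b E p 2"
proof (intro equalityI subsetI)
  fix e assume e: "e \<in> E"
  then have "card e = 2" using assms(2) by (auto simp: simple_graph_def)
  then obtain i j where ij: "e = {i, j}" by (meson card_2_iff)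
  then have "\<exists>!k. attains b (p i - p j) k" using wp e unfolding well_positioned_def by blast
  then obtain k where "dominant b (p i - p j) k" using ex1_attains_imp_dominant by blast
  then have "e \<in> monochrome_subgraph b E p k" using e ij monochrome_iff[OF wp] by blast
  then show "e \<in> monochrome_subgraph b E p 1 \<union> monochrome_subgraph b E p 2"
    using exhaust_2[of k] by auto
qed (use monochrome_subset in blast)

lemma infinitesimal_flex_iff_compatible:
  assumes wp: "well_positioned b E p"
  shows "infinitesimal_flex (quad_norm b) E p u \<longleftrightarrow>
    (\<forall>k. compatible (monochrome_subgraph b E p k) (\<lambda>v. u v \<bullet> b k))"
proof -
  have arg: "(p i + t *\<^sub>R u i) - (p j + t *\<^sub>R u j) = (p i - p j) + t *\<^sub>R (u i - u j)" for i j t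
    by (simp add: algebra_simps)
  have flex: "(\<lambda>t. quad_norm b ((p i + t *\<^sub>R u i) - (p j + t *\<^sub>R u j)) - quad_norm b (p i - p j))
      \<in> o[at 0](\<lambda>t::real. t) \<longleftrightarrow> u i \<bullet> b k = u j \<bullet> b k" if "dominant b (p i - p j) k" for i j k
    unfolding arg quad_norm_little_o_iff[OF that] by (simp add: inner_diff_left)
  have ex: "\<exists>k. dominant b (p i - p j) k" if "{i, j} \<in> E" for i j
  proof (rule ex1_attains_imp_dominant)
    show "\<exists>!k. attains b (p i - p j) k" using wp that by (simp add: well_positioned_def)
  qed
  show ?thesis
  proof
    assume u: "infinitesimal_flex (quad_norm b) E p u"
    show "\<forall>k. compatible (monochrome_subgraph b E p k) (\<lambda>v. u v \<bullet> b k)"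
      unfolding compatible_def
    proof (intro allI impI)
      fix k i j assume "{i, j} \<in> monochrome_subgraph b E p k"
      then have ij: "{i, j} \<in> E" "dominant b (p i - p j) k" by (simp_all add: monochrome_iff[OF wp])
      then show "u i \<bullet> b k = u j \<bullet> b k"
        using u[unfolded infinitesimal_flex_def, rule_format, OF ij(1)] flex[OF ij(2)] by blast
    qed
  next
    assume u: "\<forall>k. compatible (monochrome_subgraph b E p k) (\<lambda>v. u v \<bullet> b k)"
    show "infinitesimal_flex (quad_norm b) E p u"
      unfolding infinitesimal_flex_def
    proof (intro allI impI)
      fix i j assume ij: "{i, j} \<in> E"
      obtain k where k: "dominant b (p i - p j) k" using ex[OF ij] by blast
      with ij have "{i, j} \<in> monochrome_subgraph b E p k" by (simp add: monochrome_iff[OF wp])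
      then have "u i \<bullet> b k = u j \<bullet> b k" using compatibleD[OF u[rule_format]] by blast
      then show "(\<lambda>t. quad_norm b ((p i + t *\<^sub>R u i) - (p j + t *\<^sub>R u j)) - quad_norm b (p i - p j))
          \<in> o[at 0](\<lambda>t::real. t)"
        using flex[OF k] by blast
    qed
  qed
qed

lemma infinitesimally_rigid_iff_connects:
  fixes p :: "'v \<Rightarrow> real^2"
  assumes b: "b 1 \<noteq> b 2" "independent {b 1, b 2}" and wp: "well_positioned b E p"
  shows "infinitesimally_rigid (quad_norm b) E p \<longleftrightarrow>
    (\<forall>k. connects UNIV (monochrome_subgraph b E p k))"
proof
  assume rigid: "infinitesimally_rigid (quad_norm b) E p"
  show "\<forall>k. connects UNIV (monochrome_subgraph b E p k)"
  proof (intro allI connectsI)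
    fix k f x y assume f: "compatible (monochrome_subgraph b E p k) f"
    obtain w where w: "\<And>l. w \<bullet> b l = (if l = k then 1 else 0)"
      using dual_vector_exists[OF b] by metis
    \<comment> \<open>A test function for colour \<open>k\<close> becomes a flex along the dual
      vector; its other coordinate is zero and thus compatible with the other colour.\<close>
    let ?u = "\<lambda>v. f v *\<^sub>R w"
    have "compatible (monochrome_subgraph b E p l) (\<lambda>v. ?u v \<bullet> b l)" for l
      using f by (auto simp: w compatible_def)
    then have "infinitesimal_flex (quad_norm b) E p ?u"
      by (simp add: infinitesimal_flex_iff_compatible[OF wp])
    then have "trivial_flex (quad_norm b) p ?u"
      using rigid by (simp add: infinitesimally_rigid_def)
    then obtain c where c: "\<forall>v. ?u v = c" unfolding trivial_flex_iff_constant[OF b] ..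
    then have "?u x \<bullet> b k = ?u y \<bullet> b k" by simp
    then show "f x = f y" by (simp add: w)
  qed
next
  assume conn: "\<forall>k. connects UNIV (monochrome_subgraph b E p k)"
  show "infinitesimally_rigid (quad_norm b) E p"
    unfolding infinitesimally_rigid_def trivial_flex_iff_constant[OF b]
  proof (intro allI impI)
    fix u assume "infinitesimal_flex (quad_norm b) E p u"
    then have u: "compatible (monochrome_subgraph b E p k) (\<lambda>v. u v \<bullet> b k)" for k
      by (simp add: infinitesimal_flex_iff_compatible[OF wp])
    have "u x = u y" for x y
    proof (rule inner_basis_eq[OF b])
      fix k
      show "u x \<bullet> b k = u y \<bullet> b k"
        by (rule connectsD[OF conn[rule_format] u]) auto
    qed
    then have "\<forall>v. u v = u undefined" by blast
    then show "\<exists>c. \<forall>v. u v = c" ..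
  qed
qed

section \<open>The rigidity matrix\<close>

definition vertex_part :: "real^('v::finite \<times> 2) \<Rightarrow> 'v \<Rightarrow> real^2" where
  "vertex_part z v = (\<chi> c. z $ (v, c))"

lemma inner_vertex_part: "x \<bullet> y = (\<Sum>v\<in>UNIV. vertex_part x v \<bullet> vertex_part y v)"
  by (simp add: inner_vec_def vertex_part_def sum.cartesian_product flip: UNIV_Times_UNIV)

text \<open>Only the vanishing of the product is stated, because this is independent of the
  orientation by \<open>Min\<close> and \<open>Max\<close>: the opposite one changes the
  sign.\<close>

lemma rigidity_row_inner:
  fixes E :: "'v::{finite,linorder} set set"
  assumes e: "{i, j} \<in> E" and "i \<noteq> j"
  shows "row {i, j} (rigidity_matrix b E p) \<bullet> z = 0 \<longleftrightarrow>
    kappa b (p i - p j) \<bullet> (vertex_part z i - vertex_part z j) = 0"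
proof -
  have main: "row {i, j} (rigidity_matrix b E p) \<bullet> z =
      kappa b (p i - p j) \<bullet> (vertex_part z i - vertex_part z j)" if ij: "i < j" "{i, j} \<in> E" for i j
  proof -
    let ?k = "kappa b (p i - p j)"
    have mm: "Min {i, j} = i" "Max {i, j} = j" using ij(1) by (simp_all add: min_absorb1 max_absorb2 less_imp_le)
    have "vertex_part (row {i, j} (rigidity_matrix b E p)) v =
        (if v = i then ?k else if v = j then - ?k else 0)" for v
      using ij(2) by (auto simp: vertex_part_def row_def rigidity_matrix_def Let_def mm vec_eq_iff)
    then have "row {i, j} (rigidity_matrix b E p) \<bullet> z =
        (\<Sum>v\<in>UNIV. (if v = i then ?k else if v = j then - ?k else 0) \<bullet> vertex_part z v)"
      by (simp add: inner_vertex_part)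
    also have "\<dots> = (\<Sum>v\<in>{i, j}. (if v = i then ?k else if v = j then - ?k else 0) \<bullet> vertex_part z v)"
      by (rule sum.mono_neutral_right) auto
    also have "\<dots> = ?k \<bullet> (vertex_part z i - vertex_part z j)"
      using ij(1) by (simp add: inner_diff_right)
    finally show ?thesis .
  qed
  show ?thesis
  proof (cases "i < j")
    case True
    then show ?thesis using main e by simp
  next
    case False
    then have ji: "j < i" using assms(2) by simp
    have "kappa b (p j - p i) = kappa b (p i - p j)" using kappa_minus[of b "p i - p j"] by simp
    then show ?thesis
      using main[OF ji] e by (auto simp: insert_commute inner_diff_right)
  qed
qed

text \<open>The null space of the rigidity matrix, written without choosing an orientation. An edge
  with \<open>kappa\<close> equal to 0 imposes no condition.\<close>

definition rigidity_kernel ::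
  "(2 \<Rightarrow> real^2) \<Rightarrow> 'v::{finite,linorder} set set \<Rightarrow> ('v \<Rightarrow> real^2) \<Rightarrow> (real^('v \<times> 2)) set" where
  "rigidity_kernel b E p =
    {z. \<forall>i j. {i, j} \<in> E \<longrightarrow> kappa b (p i - p j) \<bullet> (vertex_part z i - vertex_part z j) = 0}"

lemma rigidity_kernel_orthogonal:
  assumes "simple_graph E"
  shows "rigidity_kernel b E p =
    {z \<in> UNIV. \<forall>r \<in> span ((\<lambda>e. row e (rigidity_matrix b E p)) ` E). orthogonal r z}"
proof -
  let ?r = "\<lambda>e. row e (rigidity_matrix b E p)"
  have "z \<in> rigidity_kernel b E p \<longleftrightarrow> (\<forall>e\<in>E. orthogonal (?r e) z)" for z
  proof
    assume z: "z \<in> rigidity_kernel b E p"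
    show "\<forall>e\<in>E. orthogonal (?r e) z"
    proof
      fix e assume e: "e \<in> E"
      then have "card e = 2" using assms by (auto simp: simple_graph_def)
      then obtain i j where "e = {i, j}" "i \<noteq> j" by (meson card_2_iff)
      then show "orthogonal (?r e) z"
        using z e rigidity_row_inner[of i j E] by (auto simp: orthogonal_def rigidity_kernel_def)
    qed
  next
    assume z: "\<forall>e\<in>E. orthogonal (?r e) z"
    show "z \<in> rigidity_kernel b E p"
      unfolding rigidity_kernel_def
    proof (intro CollectI allI impI)
      fix i j assume e: "{i, j} \<in> E"
      then have "i \<noteq> j" using assms by (auto simp: simple_graph_def)
      then show "kappa b (p i - p j) \<bullet> (vertex_part z i - vertex_part z j) = 0"
        using z e rigidity_row_inner[OF e] by (auto simp: orthogonal_def)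
    qed
  qed
  moreover have "(\<forall>e\<in>E. orthogonal (?r e) z) \<longleftrightarrow> (\<forall>r \<in> span (?r ` E). orthogonal r z)" for z
  proof
    assume "\<forall>e\<in>E. orthogonal (?r e) z"
    then have "orthogonal z r" if "r \<in> span (?r ` E)" for r
      by (intro orthogonal_to_span[OF that]) (auto simp: orthogonal_commute)
    then show "\<forall>r \<in> span (?r ` E). orthogonal r z" by (simp add: orthogonal_commute)
  qed (simp add: span_base)
  ultimately show ?thesis by auto
qed

text \<open>Rank-nullity, with the kernel seen as the orthogonal complement of the row
  space.\<close>

lemma dim_rigidity_kernel:
  fixes E :: "'v::{finite,linorder} set set"
  assumes "simple_graph E"
  shows "dim (rigidity_kernel b E p) + rank (rigidity_matrix b E p) = DIM(real^('v \<times> 2))"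
  using dim_subspace_orthogonal_to_vectors[OF subspace_span subspace_UNIV subset_UNIV,
      of "(\<lambda>e. row e (rigidity_matrix b E p)) ` E"]
  unfolding rigidity_kernel_orthogonal[OF assms] rank_rigidity_matrix by simp

lemma subspace_rigidity_kernel:
  assumes "simple_graph E"
  shows "subspace (rigidity_kernel b E p)"
  unfolding rigidity_kernel_orthogonal[OF assms]
  by (auto simp: subspace_def orthogonal_clauses)

section \<open>From tight graphs to rigid frameworks, and the equivalences\<close>

lemma tight_2_2_imp_tight:
  fixes E :: "'v::finite set set"
  assumes "simple_graph E" "tight_2_2 E"
  shows "tight UNIV E"
  unfolding tight_def
proof (intro conjI allI impI ballI)
  show "card e = 2" if "e \<in> E" for e using assms(1) that by (simp add: simple_graph_def)
  show "card E + 2 = 2 * card (UNIV :: 'v set)"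
    using assms(2) unfolding tight_2_2_def by linarith
  fix X :: "'v set" assume "X \<noteq> {}"
  moreover have "{e \<in> E. e \<subseteq> X} \<subseteq> E" "\<Union>{e \<in> E. e \<subseteq> X} \<subseteq> X" by auto
  ultimately have "int (card {e \<in> E. e \<subseteq> X}) \<le> 2 * int (card X) - 2"
    using assms(2) unfolding tight_2_2_def sparse_2_2_def by blast
  then show "card {e \<in> E. e \<subseteq> X} + 2 \<le> 2 * card X" by linarith
qed auto

lemma abs_diff_less_abs_add:
  fixes x y :: real
  assumes "0 < x * y"
  shows "\<bar>x - y\<bar> < \<bar>x + y\<bar>"
  using assms by (auto simp: zero_less_mult_iff)

text \<open>
  In the coordinates \<open>s + t\<close> and \<open>s - t\<close>, an edge has colour 1 if it is concordant and colour 2 if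
  it is discordant.
\<close>

lemma connecting_orders_imp_realisation:
  fixes E :: "'v::{finite,linorder} set set"
  assumes b: "b 1 \<noteq> b 2" "independent {b 1, b 2}"
    and orders: "connecting_orders UNIV E s t"
  shows "\<exists>p. \<forall>z\<in>rigidity_kernel b E p. \<forall>i j. vertex_part z i = vertex_part z j"
proof -
  obtain w1 where w1: "\<And>l. w1 \<bullet> b l = (if l = 1 then 1 else 0)"
    using dual_vector_exists[OF b, of 1] by metis
  obtain w2 where w2: "\<And>l. w2 \<bullet> b l = (if l = 2 then 1 else 0)"
    using dual_vector_exists[OF b, of 2] by metis
  \<comment> \<open>As \<open>w1\<close> and \<open>w2\<close> form the dual basis, the inner
    products of \<open>p v\<close> with \<open>b 1\<close> and \<open>b 2\<close> are exactly
    \<open>s v + t v\<close> and \<open>s v - t v\<close>.\<close>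
  define p where "p v = (s v + t v) *\<^sub>R w1 + (s v - t v) *\<^sub>R w2" for v
  have p1: "(p i - p j) \<bullet> b 1 = (s i - s j) + (t i - t j)"
    and p2: "(p i - p j) \<bullet> b 2 = (s i - s j) - (t i - t j)" for i j
    by (simp_all add: p_def inner_add_left inner_diff_left w1 w2)
  have conc: "dominant b (p i - p j) 1" if "0 < (s i - s j) * (t i - t j)" for i j
    using abs_diff_less_abs_add[OF that] by (simp add: dominant_def forall_2 p1 p2)
  have disc: "dominant b (p i - p j) 2" if "0 < (s i - s j) * (- t i - - t j)" for i j
    using abs_diff_less_abs_add[OF that] by (simp add: dominant_def forall_2 p1 p2)
  have "vertex_part z x = vertex_part z y" if z: "z \<in> rigidity_kernel b E p" for z x y
  proof (rule inner_basis_eq[OF b])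
    fix k
    have "compatible (concordant E s t) (\<lambda>v. vertex_part z v \<bullet> b 1)"
      unfolding compatible_def
    proof (intro allI impI)
      fix i j assume ij: "{i, j} \<in> concordant E s t"
      then have "kappa b (p i - p j) = b 1" "{i, j} \<in> E"
        using kappa_dominant[OF conc] by (auto simp: concordant_iff)
      then have "b 1 \<bullet> (vertex_part z i - vertex_part z j) = 0"
        using z unfolding rigidity_kernel_def by force
      then show "vertex_part z i \<bullet> b 1 = vertex_part z j \<bullet> b 1"
        by (simp add: inner_diff_right inner_commute)
    qed
    moreover have "compatible (concordant E s (\<lambda>v. - t v)) (\<lambda>v. vertex_part z v \<bullet> b 2)"
      unfolding compatible_def
    proof (intro allI impI)
      fix i j assume ij: "{i, j} \<in> concordant E s (\<lambda>v. - t v)"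
      then have "kappa b (p i - p j) = b 2" "{i, j} \<in> E"
        using kappa_dominant[OF disc] unfolding concordant_iff by blast+
      then have "b 2 \<bullet> (vertex_part z i - vertex_part z j) = 0"
        using z unfolding rigidity_kernel_def by force
      then show "vertex_part z i \<bullet> b 2 = vertex_part z j \<bullet> b 2"
        by (simp add: inner_diff_right inner_commute)
    qed
    moreover have conn: "connects UNIV (concordant E s t)"
      "connects UNIV (concordant E s (\<lambda>v. - t v))"
      using orders by (simp_all add: connecting_orders_def)
    ultimately have "vertex_part z x \<bullet> b 1 = vertex_part z y \<bullet> b 1"
      "vertex_part z x \<bullet> b 2 = vertex_part z y \<bullet> b 2"
      using connectsD[OF conn(1), of _ x y] connectsD[OF conn(2), of _ x y] by simp_all
    then show "vertex_part z x \<bullet> b k = vertex_part z y \<bullet> b k"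
      using exhaust_2[of k] by auto
  qed
  then show ?thesis by blast
qed

text \<open>Constant vectors lie in every kernel, and the kernel of the constructed placement
  \<open>p'\<close> contains nothing else. Regularity makes the kernel of \<open>p\<close> at most
  as large in dimension, so the two kernels coincide.\<close>

lemma regular_tight_imp_rigid:
  fixes E :: "'v::{finite,linorder} set set"
  assumes b: "b 1 \<noteq> b 2" "independent {b 1, b 2}"
    and simple: "simple_graph E" and wp: "well_positioned b E p"
    and reg: "regular b E p" and tight: "tight_2_2 E"
  shows "infinitesimally_rigid (quad_norm b) E p"
proof -
  obtain s t where "connecting_orders UNIV E s t"
    using tight_imp_connecting_orders[OF tight_2_2_imp_tight[OF simple tight]] by blast
  from connecting_orders_imp_realisation[OF b this]
  obtain p' where p': "\<forall>z\<in>rigidity_kernel b E p'. \<forall>i j. vertex_part z i = vertex_part z j" ..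
  have "rigidity_kernel b E p' \<subseteq> rigidity_kernel b E p"
  proof
    fix z assume "z \<in> rigidity_kernel b E p'"
    then have "vertex_part z i = vertex_part z j" for i j using p' by blast
    then have "vertex_part z i - vertex_part z j = 0" for i j by simp
    then show "z \<in> rigidity_kernel b E p"
      unfolding rigidity_kernel_def by (simp only: mem_Collect_eq inner_zero_right simp_thms)
  qed
  moreover have "dim (rigidity_kernel b E p) \<le> dim (rigidity_kernel b E p')"
  proof -
    have "rank (rigidity_matrix b E p') \<le> rank (rigidity_matrix b E p)"
      using reg by (simp add: regular_def)
    then show ?thesis
      using dim_rigidity_kernel[OF simple, of b p] dim_rigidity_kernel[OF simple, of b p'] by linarith
  qed
  ultimately have ker: "rigidity_kernel b E p' = rigidity_kernel b E p"
    by (intro subspace_dim_equal subspace_rigidity_kernel[OF simple])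
  show ?thesis
    unfolding infinitesimally_rigid_def trivial_flex_iff_constant[OF b]
  proof (intro allI impI)
    fix u assume "infinitesimal_flex (quad_norm b) E p u"
    then have u: "compatible (monochrome_subgraph b E p k) (\<lambda>v. u v \<bullet> b k)" for k
      by (simp add: infinitesimal_flex_iff_compatible[OF wp])
    define z :: "real^('v \<times> 2)" where "z = (\<chi> vc. u (fst vc) $ snd vc)"
    have z: "vertex_part z v = u v" for v by (simp add: z_def vertex_part_def vec_eq_iff)
    have "z \<in> rigidity_kernel b E p"
      unfolding rigidity_kernel_def
    proof (intro CollectI allI impI)
      fix i j assume ij: "{i, j} \<in> E"
      have "\<exists>k. dominant b (p i - p j) k"
        by (rule ex1_attains_imp_dominant) (use wp ij in \<open>simp add: well_positioned_def\<close>)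
      then obtain k where k: "dominant b (p i - p j) k" ..
      then have "u i \<bullet> b k = u j \<bullet> b k"
        using ij by (intro compatibleD[OF u]) (simp add: monochrome_iff[OF wp])
      then show "kappa b (p i - p j) \<bullet> (vertex_part z i - vertex_part z j) = 0"
        by (simp add: z kappa_dominant[OF k] inner_diff_right inner_commute)
    qed
    then have "vertex_part z i = vertex_part z j" for i j using p' ker by blast
    then have "u i = u j" for i j by (simp only: z)
    then have "\<forall>v. u v = u undefined" by blast
    then show "\<exists>c. \<forall>v. u v = c" ..
  qed
qed

text \<open>Deleting an edge affects only the class of its colour. Minimality of the framework
  therefore splits into minimal connectedness of each class, which characterises spanning
  trees.\<close>

lemma minimally_rigid_iff_spanning_trees:
  fixes p :: "'v::finite \<Rightarrow> real^2"
  assumes b: "b 1 \<noteq> b 2" "independent {b 1, b 2}"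
    and simple: "simple_graph E" and wp: "well_positioned b E p"
  shows "minimally_infinitesimally_rigid (quad_norm b) E p \<longleftrightarrow>
    (\<forall>k. spanning_tree (monochrome_subgraph b E p k) E)"
proof -
  let ?G = "monochrome_subgraph b E p"
  have rigid: "infinitesimally_rigid (quad_norm b) (E - {e}) p \<longleftrightarrow> (\<forall>l. connects UNIV (?G l - {e}))"
    for e
    using infinitesimally_rigid_iff_connects[OF b well_positioned_subset[OF wp], of "E - {e}"]
    by (simp add: monochrome_Diff Diff_subset)
  have simpleG: "simple_graph (?G k)" for k
    using simple monochrome_subset[of b E p k] unfolding simple_graph_def by blast
  have tree: "spanning_tree (?G k) E \<longleftrightarrow>
      connects UNIV (?G k) \<and> (\<forall>e\<in>?G k. \<not> connects UNIV (?G k - {e}))" for k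
    using spanning_tree_iff_connects[OF simpleG] monochrome_subset[of b E p k] by blast
  have edges: "e \<in> E \<longleftrightarrow> (\<exists>k. e \<in> ?G k)" for e
    using monochrome_cover[OF wp simple] monochrome_subset[of b E p] by blast
  have other: "?G l - {e} = ?G l" if "e \<in> ?G k" "l \<noteq> k" for e k l
    using that monochrome_disjoint[OF wp] exhaust_2[of k] exhaust_2[of l] by auto
  have "(\<exists>l. \<not> connects UNIV (?G l - {e})) \<longleftrightarrow> \<not> connects UNIV (?G k - {e})"
    if "e \<in> ?G k" "\<forall>l. connects UNIV (?G l)" for e k
    using other[OF that(1)] that(2) by metis
  then show ?thesis
    unfolding minimally_infinitesimally_rigid_def rigid tree
      infinitesimally_rigid_iff_connects[OF b wp]
    using edges by blast
qed

theorem theorem4p10: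
  fixes b :: "2 \<Rightarrow> real^2"
    and E :: "'v::{finite,linorder} set set"
    and p :: "'v \<Rightarrow> real^2"
  assumes "b 1 \<noteq> b 2" and "independent {b 1, b 2}"
    and "simple_graph E" and "connected_graph E"
    and "well_positioned b E p" and "regular b E p"
  shows "(minimally_infinitesimally_rigid (quad_norm b) E p
            \<longleftrightarrow> spanning_tree (monochrome_subgraph b E p 1) E
                \<and> spanning_tree (monochrome_subgraph b E p 2) E
                \<and> monochrome_subgraph b E p 1 \<inter> monochrome_subgraph b E p 2 = {})
       \<and> (minimally_infinitesimally_rigid (quad_norm b) E p \<longleftrightarrow> tight_2_2 E)"
proof -
  note b = assms(1,2) and simple = assms(3) and wp = assms(5)
  let ?G = "monochrome_subgraph b E p"
  have min_iff: "minimally_infinitesimally_rigid (quad_norm b) E p \<longleftrightarrow>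
      (\<forall>k. spanning_tree (?G k) E)"
    by (rule minimally_rigid_iff_spanning_trees[OF b simple wp])
  note cover = monochrome_cover[OF wp simple] and disjoint = monochrome_disjoint[OF wp]
  have simpleG: "simple_graph (?G k)" for k
    using simple monochrome_subset[of b E p k] unfolding simple_graph_def by blast
  \<comment> \<open>Kept general in \<open>F\<close>: the whole of \<open>E\<close> gives the lower
    bound for tightness, and \<open>E - {e}\<close> later shows that no edge of a tight graph can be
    spared.\<close>
  have conn_card: "2 * CARD('v) \<le> card F + 2"
    if F: "F \<subseteq> E" and conn: "\<And>k. connects UNIV (?G k \<inter> F)" for F
  proof -
    have "CARD('v) \<le> Suc (card (?G k \<inter> F))" for k
      by (rule connects_card[OF _ _ conn]) auto
    from this[of 1] this[of 2] have "2 * CARD('v) \<le> card (?G 1 \<inter> F) + card (?G 2 \<inter> F) + 2"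
      by linarith
    moreover have "card ((?G 1 \<inter> F) \<union> (?G 2 \<inter> F)) = card (?G 1 \<inter> F) + card (?G 2 \<inter> F)"
      by (rule card_Un_disjoint) (use disjoint in auto)
    moreover have "(?G 1 \<inter> F) \<union> (?G 2 \<inter> F) = F" using F cover by blast
    ultimately show ?thesis by simp
  qed
  have "tight_2_2 E" if trees: "\<forall>k. spanning_tree (?G k) E"
  proof -
    have tree: "connects UNIV (?G k)" "separated (?G k)" for k
      using trees[rule_format, of k] minimally_connects_separated[of "?G k"]
      unfolding spanning_tree_iff_connects[OF simpleG] by auto
    \<comment> \<open>Each colour restricted to \<open>F\<close> is a forest on \<open>W\<close> and
      contributes at most \<open>card W - 1\<close> edges.\<close>
    have bound: "card F + 2 \<le> 2 * card W" if W: "W \<noteq> {}" "F \<subseteq> E" "\<Union>F \<subseteq> W" for W F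
    proof -
      have "Suc (card (?G k \<inter> F)) \<le> card W" for k
      proof (rule separated_card)
        show "separated (?G k \<inter> F)" by (rule separated_subset[OF tree(2)[of k]]) simp
        show "\<forall>e\<in>?G k \<inter> F. card e = 2" using simpleG[of k] by (simp add: simple_graph_def)
      qed (use W in auto)
      from this[of 1] this[of 2] have "card (?G 1 \<inter> F) + card (?G 2 \<inter> F) + 2 \<le> 2 * card W"
        by linarith
      moreover have "card ((?G 1 \<inter> F) \<union> (?G 2 \<inter> F)) \<le> card (?G 1 \<inter> F) + card (?G 2 \<inter> F)"
        by (rule card_Un_le)
      moreover have "(?G 1 \<inter> F) \<union> (?G 2 \<inter> F) = F" using W(2) cover by blast
      ultimately show ?thesis by simp
    qed
    have "int (card F) \<le> 2 * int (card W) - 2" if "W \<noteq> {}" "F \<subseteq> E" "\<Union>F \<subseteq> W" for W F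
      using bound[OF that] by linarith
    moreover have "connects UNIV (?G k \<inter> E)" for k
      using tree(1)[of k] monochrome_subset[of b E p k] by (simp add: Int_absorb2)
    then have "2 * CARD('v) \<le> card E + 2" by (intro conn_card) auto
    moreover have "card E + 2 \<le> 2 * CARD('v)" by (rule bound) auto
    ultimately show ?thesis unfolding tight_2_2_def sparse_2_2_def by auto
  qed
  moreover have "minimally_infinitesimally_rigid (quad_norm b) E p" if tight: "tight_2_2 E"
    unfolding minimally_infinitesimally_rigid_def
  proof (intro conjI ballI notI)
    show "infinitesimally_rigid (quad_norm b) E p"
      by (rule regular_tight_imp_rigid[OF b simple wp assms(6) tight])
    fix e assume e: "e \<in> E" and rigid: "infinitesimally_rigid (quad_norm b) (E - {e}) p"
    have "connects UNIV (?G k \<inter> (E - {e}))" for k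
    proof -
      have "?G k \<inter> (E - {e}) = monochrome_subgraph b (E - {e}) p k"
        using monochrome_subset[of b E p k] by (auto simp: monochrome_Diff)
      then show ?thesis
        using rigid infinitesimally_rigid_iff_connects[OF b well_positioned_subset[OF wp], of "E - {e}"]
        by (simp add: Diff_subset)
    qed
    \<comment> \<open>A rigid framework still has at least \<open>2 * CARD('v) - 2\<close> edges
      after the deletion, one more than tightness leaves.\<close>
    then have "2 * CARD('v) \<le> card (E - {e}) + 2" by (intro conn_card) auto
    moreover have "card (E - {e}) + 1 = card E"
      using e by (metis Suc_eq_plus1 card_Suc_Diff1 finite)
    moreover have "card E + 2 = 2 * CARD('v)"
      using tight unfolding tight_2_2_def by linarith
    ultimately show False by linarith
  qed
  ultimately have "minimally_infinitesimally_rigid (quad_norm b) E p \<longleftrightarrow> tight_2_2 E"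
    using min_iff by (metis (no_types))
  then show ?thesis
    using disjoint unfolding min_iff forall_2 by (simp only: simp_thms)
qed

end
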